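(* Let $V,W$ be $n$-graded vector spaces, $E$ the $(n+1)$-graded vector space with $E^{(0,* )}=V$, $E^{(1,* )}=W$, $E^{(k,* )}=0$ otherwise, and let $P\in M^{(1,0,\dots,0)}(E)$ satisfy $[P,P]^{\Delta}=0$, with associated multigraded associative algebra $\mathcal A=(V,\mu)$ and multigraded $\mathcal A$-bimodule $\mathcal M=(W,\lambda,\rho)$. Let $\nu:W\times W\to W$ be a multigraded algebra structure, so $\nu\in M^{(1,-1,0,\dots,0)}(E)$, and set $C_1\bullet C_2:=[C_1,[C_2,\nu]^{\Delta}]^{\Delta}$ for $C_i\in L^{(k_i,c_i)}(V,W)$. (1) The mapping $[P,\cdot]^{\Delta}:M(E)\to M(E)$ is a differential. Denote its restriction to $L(V,W)$ by $\delta_P$. This generalizes the Hochschild coboundary operator to the multigraded case: if $C\in L^{(k,c)}(V,W)$, then for $X_i\in V^{x_i}$ $$(\delta_PC)(X_0,\dots,X_k)=\lambda(X_0)C(X_1,\dots,X_k)-\sum_{i=0}^{k-1}(-1)^iC(X_0,\dots,\mu(X_i,X_{i+1}),\dots,X_k)+(-1)^{k+1+\langle x_0+\dots+x_{k-1}+c,\,x_k\rangle}\rho(X_k)C(X_0,\dots,X_{k-1}).$$ The corresponding cohomology is denoted by $H(\mathcal A,\mathcal M)$. (2) If $[P,\nu]^{\Delta}=0$, then $\delta_P$ is a derivation of $(L(V,W),\bullet)$ of multidegree $(1,0,\dots,0)$, i.e. $\delta_P(C_1\bullet C_2)=\delta_PC_1\bullet C_2+(-1)^{k_1-1}C_1\bullet\delta_PC_2$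 for $C_1\in L^{(k_1,c_1)}(V,W)$, $C_2\in L(V,W)$. In this case the product $\bullet$ carries over to a multigraded (cup) product on $H(\mathcal A,\mathcal M)$.
   Context: All vector spaces are over a field $\mathbb K$ of characteristic $0$. For $x,y\in\mathbb Z^m$ put $\langle x,y\rangle=\sum_i x^iy^i$. An $m$-graded vector space is $U=\bigoplus_{x\in\mathbb Z^m}U^x$; the degree of a homogeneous element $X_i$ is denoted $x_i$. A multigraded algebra structure on an $m$-graded space is a bilinear multiplication of weight $0$ (it adds degrees). A differential is a linear map with square $0$. For an $m$-graded space $U$, $M(U)=\bigoplus_{(k,\kappa)\in\mathbb Z\times\mathbb Z^m}M^{(k,\kappa)}(U)$, where $M^{(k,\kappa)}(U)$ is the space of $(k+1)$-linear maps $K:U\times\dots\times U\to U$ with $K(U^{x_0}\times\dots\times U^{x_k})\subseteq U^{x_0+\dots+x_k+\kappa}$ ($M^{(-1,\kappa)}(U)=U^\kappa$; zero for $k<-1$). For $K_i\in M^{(k_i,\kappa_i)}(U)$, $$(j(K_1)K_2)(X_0,\dots,X_{k_1+k_2})=\sum_{i=0}^{k_2}(-1)^{k_1i+\langle\kappa_1,\kappa_2+x_0+\dots+x_{i-1}\rangle}K_2(X_0,\dots,K_1(X_i,\dots,X_{i+k_1}),\dots,X_{k_1+k_2})$$ (zero if $k_2=-1$), and $[K_1,K_2]^{\Delta}=j(K_1)K_2-(-1)^{k_1k_2+\langle\kappa_1,\kappa_2\rangle}j(K_2)K_1$; this makes $M(U)$ an $(m+1)$-graded Lie algebra. Given $P\in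 M^{(1,0,\dots,0)}(E)$ (bilinear, weight $0\in\mathbb Z^{n+1}$), put, for homogeneous $X,X_i\in V$ and $Y\in W$: $\mu(X_1,X_2)=P(X_1,X_2)\in V$, $\lambda(X)Y=P(X,Y)\in W$, $\rho(X)Y=(-1)^{\langle x,y\rangle}P(Y,X)\in W$ ($x,y\in\mathbb Z^n$ the degrees). The condition $[P,P]^{\Delta}=0$ means that $\mu$ is associative and $\lambda(\mu(X_1,X_2))=\lambda(X_1)\lambda(X_2)$, $\rho(\mu(X_1,X_2))=(-1)^{\langle x_1,x_2\rangle}\rho(X_2)\rho(X_1)$, $\lambda(X_1)\rho(X_2)=(-1)^{\langle x_1,x_2\rangle}\rho(X_2)\lambda(X_1)$, i.e. $(W,\lambda,\rho)$ is a multigraded bimodule over $(V,\mu)$. $L^{(k,c)}(V,W)$ ($k\ge0$, $c\in\mathbb Z^n$) is the space of $k$-linear maps $C:V\times\dots\times V\to W$ with $C(V^{x_1}\times\dots\times V^{x_k})\subseteq W^{x_1+\dots+x_k+c}$ (for $k=0$: $W^c$), and $L(V,W)=\bigoplus_{k,c}L^{(k,c)}(V,W)$. Extending multilinear maps by zero, $L^{(k,c)}(V,W)=M^{(k-1,1,c)}(E)$, so elements of $L^{(k,c)}(V,W)$ have multidegree $(k-1,1,c)$ in $M(E)$; signs in the derivation rule are taken with respect to these multidegrees. Likewise $\nu$ is extended by zero to $E\times E$. $H(\mathcal A,\mathcal M)=\ker\delta_P/\operatorname{im}\delta_P$ is the cohomology of $(L(V,W),\delta_P)$.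
   Formalization: The displayed formula for δ_P C is false as printed for δ_P = [P,·]^Δ; it is proved with an overall factor −1 on the right-hand side and an extra sign (−1)^{⟨x_0,c⟩} on the term λ(X_0)C(X_1,…,X_k). *)

theory Defs
  imports
    "HOL-Analysis.Product_Vector"
    "HOL-Library.Function_Algebras"
    "HOL-Library.Set_Algebras"
begin

text \<open>
  An element of \<open>\<int>\<^sup>m\<close> is a function on the naturals that vanishes from \<open>m\<close> on, so \<open>m = 0\<close> is
  included, and the pair of \<open>a \<in> \<int>\<close> and \<open>x \<in> \<int>\<^sup>n\<close> is the element \<open>case_nat a x\<close> of \<open>\<int>\<^bsup>n+1\<^esup>\<close>.
\<close>

type_synonym deg = "nat \<Rightarrow> int"

definition degs :: "nat \<Rightarrow> deg set" where
  "degs m = {x. \<forall>i\<ge>m. x i = 0}"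

definition deg_inner :: "nat \<Rightarrow> deg \<Rightarrow> deg \<Rightarrow> int" where
  "deg_inner m x y = (\<Sum>i<m. x i * y i)"

text \<open>
  Internal direct sums. A grading is given by its pieces, indexed by a whole type; the pieces
  at indices that are not degrees are \<open>{0}\<close>. The component is meaningful only for elements that
  have a unique decomposition.
\<close>

definition decomposes :: "('d \<Rightarrow> 'a::comm_monoid_add set) \<Rightarrow> 'a \<Rightarrow> ('d \<Rightarrow> 'a) \<Rightarrow> bool" where
  "decomposes G X f \<longleftrightarrow>
     (\<forall>d. f d \<in> G d) \<and> finite {d. f d \<noteq> 0} \<and> X = (\<Sum>d | f d \<noteq> 0. f d)"

definition component :: "('d \<Rightarrow> 'a::comm_monoid_add set) \<Rightarrow> 'a \<Rightarrow> 'd \<Rightarrow> 'a" where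
  "component G X = (THE f. decomposes G X f)"

definition dsum :: "('d \<Rightarrow> 'a::comm_monoid_add set) \<Rightarrow> 'a set" where
  "dsum G = {X. \<exists>f. decomposes G X f}"

record ('k, 'a) gspace =
  grank :: nat
  gscale :: "'k \<Rightarrow> 'a \<Rightarrow> 'a"
  gpiece :: "deg \<Rightarrow> 'a set"

definition graded_space :: "nat \<Rightarrow> ('k::field, 'a::ab_group_add) gspace \<Rightarrow> bool" where
  "graded_space m U \<longleftrightarrow>
     grank U = m \<and> vector_space (gscale U) \<and>
     (\<forall>x. module.subspace (gscale U) (gpiece U x)) \<and>
     (\<forall>x. x \<notin> degs m \<longrightarrow> gpiece U x = {0}) \<and>
     (\<forall>X. \<exists>!f. decomposes (gpiece U) X f)"

text \<open>
  A \<open>p\<close>-linear map is a function on lists that is \<open>0\<close> on lists of length other than \<open>p\<close>; hence maps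
  of different arity can be added, and the direct sums over all arities below are internal.
\<close>

definition multilinear ::
  "('k::field \<Rightarrow> 'a::ab_group_add \<Rightarrow> 'a) \<Rightarrow> ('k \<Rightarrow> 'b::ab_group_add \<Rightarrow> 'b) \<Rightarrow> nat \<Rightarrow>
   ('a list \<Rightarrow> 'b) \<Rightarrow> bool" where
  "multilinear s t p f \<longleftrightarrow>
     (\<forall>Xs. length Xs \<noteq> p \<longrightarrow> f Xs = 0) \<and>
     (\<forall>Xs i. length Xs = p \<longrightarrow> i < p \<longrightarrow> Vector_Spaces.linear s t (\<lambda>X. f (Xs[i := X])))"

definition homogeneous_list :: "('k, 'a) gspace \<Rightarrow> deg list \<Rightarrow> 'a list \<Rightarrow> bool" where
  "homogeneous_list U xs Xs \<longleftrightarrow> list_all2 (\<lambda>x X. X \<in> gpiece U x) xs Xs"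

definition mlin ::
  "('k::field, 'a::ab_group_add) gspace \<Rightarrow> ('k, 'b::ab_group_add) gspace \<Rightarrow> nat \<Rightarrow> deg \<Rightarrow>
   ('a list \<Rightarrow> 'b) set" where
  "mlin U U' p c =
     {f. multilinear (gscale U) (gscale U') p f \<and>
         (\<forall>xs Xs. length xs = p \<longrightarrow> homogeneous_list U xs Xs \<longrightarrow>
            f Xs \<in> gpiece U' (sum_list xs + c))}"

definition fscale :: "('k, 'b) gspace \<Rightarrow> 'k \<Rightarrow> ('a \<Rightarrow> 'b) \<Rightarrow> 'a \<Rightarrow> 'b" where
  "fscale U r f = (\<lambda>X. gscale U r (f X))"

definition M_hom ::
  "('k::field, 'a::ab_group_add) gspace \<Rightarrow> int \<times> deg \<Rightarrow> ('a list \<Rightarrow> 'a) set" where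
  "M_hom U = (\<lambda>(k, \<kappa>). if k < -1 then {0} else mlin U U (nat (k + 1)) \<kappa>)"

definition M_space :: "('k::field, 'a::ab_group_add) gspace \<Rightarrow> ('a list \<Rightarrow> 'a) set" where
  "M_space U = dsum (M_hom U)"

text \<open>
  \<open>j_formula\<close> is the value of \<open>j(K\<^sub>1)K\<^sub>2\<close> on homogeneous arguments \<open>Xs\<close> of degrees \<open>xs\<close>, and \<open>j_map\<close>
  its multilinear extension: the sum of these values over all tuples of homogeneous components.
  For \<open>k\<^sub>2 = -1\<close> the sum over \<open>i\<close> is empty.
\<close>

definition j_formula ::
  "('k::field, 'a::ab_group_add) gspace \<Rightarrow> int \<times> deg \<Rightarrow> ('a list \<Rightarrow> 'a) \<Rightarrow>
   int \<times> deg \<Rightarrow> ('a list \<Rightarrow> 'a) \<Rightarrow> deg list \<Rightarrow> 'a list \<Rightarrow> 'a" where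
  "j_formula U = (\<lambda>(k1, \<kappa>1) K1 (k2, \<kappa>2) K2 xs Xs.
     if int (length Xs) = k1 + k2 + 1 then
       (\<Sum>i<nat (k2 + 1).
          gscale U ((-1) powi (k1 * int i + deg_inner (grank U) \<kappa>1 (\<kappa>2 + sum_list (take i xs))))
            (K2 (take i Xs @ [K1 (take (nat (k1 + 1)) (drop i Xs))]
                 @ drop (i + nat (k1 + 1)) Xs)))
     else 0)"

definition j_map ::
  "('k::field, 'a::ab_group_add) gspace \<Rightarrow> int \<times> deg \<Rightarrow> ('a list \<Rightarrow> 'a) \<Rightarrow>
   int \<times> deg \<Rightarrow> ('a list \<Rightarrow> 'a) \<Rightarrow> 'a list \<Rightarrow> 'a" where
  "j_map U d1 K1 d2 K2 Xs =
     (\<Sum>xs | list_all2 (\<lambda>x X. component (gpiece U) X x \<noteq> 0) xs Xs.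
        j_formula U d1 K1 d2 K2 xs (map2 (\<lambda>x X. component (gpiece U) X x) xs Xs))"

definition bracket_hom ::
  "('k::field, 'a::ab_group_add) gspace \<Rightarrow> int \<times> deg \<Rightarrow> ('a list \<Rightarrow> 'a) \<Rightarrow>
   int \<times> deg \<Rightarrow> ('a list \<Rightarrow> 'a) \<Rightarrow> 'a list \<Rightarrow> 'a" where
  "bracket_hom U = (\<lambda>(k1, \<kappa>1) K1 (k2, \<kappa>2) K2.
     j_map U (k1, \<kappa>1) K1 (k2, \<kappa>2) K2 -
     fscale U ((-1) powi (k1 * k2 + deg_inner (grank U) \<kappa>1 \<kappa>2))
       (j_map U (k2, \<kappa>2) K2 (k1, \<kappa>1) K1))"

text \<open>The bracket \<open>[K\<^sub>1, K\<^sub>2]\<^sup>\<Delta>\<close> on all of \<open>M(U)\<close>, by bilinear extension.\<close>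

definition bracket ::
  "('k::field, 'a::ab_group_add) gspace \<Rightarrow> ('a list \<Rightarrow> 'a) \<Rightarrow> ('a list \<Rightarrow> 'a) \<Rightarrow> 'a list \<Rightarrow> 'a" where
  "bracket U K1 K2 =
     (\<Sum>d1 | component (M_hom U) K1 d1 \<noteq> 0. \<Sum>d2 | component (M_hom U) K2 d2 \<noteq> 0.
        bracket_hom U d1 (component (M_hom U) K1 d1) d2 (component (M_hom U) K2 d2))"

definition E_space ::
  "('k::field, 'v::ab_group_add) gspace \<Rightarrow> ('k, 'w::ab_group_add) gspace \<Rightarrow>
   ('k, 'v \<times> 'w) gspace" where
  "E_space V W =
     \<lparr>grank = Suc (grank V),
      gscale = module_prod.scale (gscale V) (gscale W),
      gpiece = (\<lambda>z. if z 0 = 0 then gpiece V (\<lambda>i. z (Suc i)) \<times> {0}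
                    else if z 0 = 1 then {0} \<times> gpiece W (\<lambda>i. z (Suc i))
                    else {0})\<rparr>"

definition mu :: "(('v \<times> 'w::zero) list \<Rightarrow> 'v \<times> 'w) \<Rightarrow> 'v \<Rightarrow> 'v \<Rightarrow> 'v" where
  "mu P X1 X2 = fst (P [(X1, 0), (X2, 0)])"

definition lam :: "(('v::zero \<times> 'w::zero) list \<Rightarrow> 'v \<times> 'w) \<Rightarrow> 'v \<Rightarrow> 'w \<Rightarrow> 'w" where
  "lam P X Y = snd (P [(X, 0), (0, Y)])"

text \<open>The sign in \<open>\<rho>(X)Y = (-1)\<^bsup>\<langle>x,y\<rangle>\<^esup> P(Y, X)\<close> needs homogeneous \<open>X\<close>, \<open>Y\<close>; extended bilinearly.\<close>

definition rho ::
  "('k::field, 'v::ab_group_add) gspace \<Rightarrow> ('k, 'w::ab_group_add) gspace \<Rightarrow>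
   (('v \<times> 'w) list \<Rightarrow> 'v \<times> 'w) \<Rightarrow> 'v \<Rightarrow> 'w \<Rightarrow> 'w" where
  "rho V W P X Y =
     (\<Sum>x | component (gpiece V) X x \<noteq> 0. \<Sum>y | component (gpiece W) Y y \<noteq> 0.
        gscale W ((-1) powi deg_inner (grank V) x y)
          (snd (P [(0, component (gpiece W) Y y), (component (gpiece V) X x, 0)])))"

definition L_hom ::
  "('k::field, 'v::ab_group_add) gspace \<Rightarrow> ('k, 'w::ab_group_add) gspace \<Rightarrow> nat \<times> deg \<Rightarrow>
   ('v list \<Rightarrow> 'w) set" where
  "L_hom V W = (\<lambda>(k, c). mlin V W k c)"

definition L_space ::
  "('k::field, 'v::ab_group_add) gspace \<Rightarrow> ('k, 'w::ab_group_add) gspace \<Rightarrow>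
   ('v list \<Rightarrow> 'w) set" where
  "L_space V W = dsum (L_hom V W)"

text \<open>Extension by zero of maps \<open>V\<^sup>k \<rightarrow> W\<close> and \<open>W\<^sup>k \<rightarrow> W\<close> to \<open>E = V \<oplus> W\<close>, and restriction to \<open>V\<close>.\<close>

definition extV :: "('v list \<Rightarrow> 'w) \<Rightarrow> ('v \<times> 'w) list \<Rightarrow> 'v::zero \<times> 'w" where
  "extV C Zs = (0, C (map fst Zs))"

definition extW :: "('w list \<Rightarrow> 'w) \<Rightarrow> ('v \<times> 'w) list \<Rightarrow> 'v::zero \<times> 'w" where
  "extW \<nu> Zs = (0, \<nu> (map snd Zs))"

definition restrV :: "(('v \<times> 'w) list \<Rightarrow> 'v \<times> 'w) \<Rightarrow> 'v list \<Rightarrow> 'w::zero" where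
  "restrV K Xs = snd (K (map (\<lambda>X. (X, 0)) Xs))"

definition delta ::
  "('k::field, 'v::ab_group_add) gspace \<Rightarrow> ('k, 'w::ab_group_add) gspace \<Rightarrow>
   (('v \<times> 'w) list \<Rightarrow> 'v \<times> 'w) \<Rightarrow> ('v list \<Rightarrow> 'w) \<Rightarrow> 'v list \<Rightarrow> 'w" where
  "delta V W P C = restrV (bracket (E_space V W) P (extV C))"

definition bullet ::
  "('k::field, 'v::ab_group_add) gspace \<Rightarrow> ('k, 'w::ab_group_add) gspace \<Rightarrow>
   ('w list \<Rightarrow> 'w) \<Rightarrow> ('v list \<Rightarrow> 'w) \<Rightarrow> ('v list \<Rightarrow> 'w) \<Rightarrow> 'v list \<Rightarrow> 'w" where
  "bullet V W \<nu> C1 C2 =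
     restrV (bracket (E_space V W) (extV C1) (bracket (E_space V W) (extV C2) (extW \<nu>)))"

definition differential_on ::
  "('k \<Rightarrow> 'a::ab_group_add \<Rightarrow> 'a) \<Rightarrow> 'a set \<Rightarrow> ('a \<Rightarrow> 'a) \<Rightarrow> bool" where
  "differential_on s S D \<longleftrightarrow>
     (\<forall>X\<in>S. D X \<in> S) \<and> (\<forall>X\<in>S. \<forall>Y\<in>S. D (X + Y) = D X + D Y) \<and>
     (\<forall>r. \<forall>X\<in>S. D (s r X) = s r (D X)) \<and> (\<forall>X\<in>S. D (D X) = 0)"

definition graded_product_on ::
  "('k \<Rightarrow> 'a::plus \<Rightarrow> 'a) \<Rightarrow> 'a set \<Rightarrow> (nat \<times> deg \<Rightarrow> 'a set) \<Rightarrow> ('a \<Rightarrow> 'a \<Rightarrow> 'a) \<Rightarrow> bool" where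
  "graded_product_on s S G f \<longleftrightarrow>
     (\<forall>A\<in>S. \<forall>B\<in>S. f A B \<in> S) \<and>
     (\<forall>A\<in>S. \<forall>A'\<in>S. \<forall>B\<in>S. f (A + A') B = f A B + f A' B \<and> f B (A + A') = f B A + f B A') \<and>
     (\<forall>r. \<forall>A\<in>S. \<forall>B\<in>S. f (s r A) B = s r (f A B) \<and> f A (s r B) = s r (f A B)) \<and>
     (\<forall>k c l d. \<forall>A\<in>G (k, c). \<forall>B\<in>G (l, d). f A B \<in> G (k + l, c + d))"

definition cocycles ::
  "('k::field, 'v::ab_group_add) gspace \<Rightarrow> ('k, 'w::ab_group_add) gspace \<Rightarrow>
   (('v \<times> 'w) list \<Rightarrow> 'v \<times> 'w) \<Rightarrow> ('v list \<Rightarrow> 'w) set" where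
  "cocycles V W P = {C \<in> L_space V W. delta V W P C = 0}"

definition coboundaries ::
  "('k::field, 'v::ab_group_add) gspace \<Rightarrow> ('k, 'w::ab_group_add) gspace \<Rightarrow>
   (('v \<times> 'w) list \<Rightarrow> 'v \<times> 'w) \<Rightarrow> ('v list \<Rightarrow> 'w) set" where
  "coboundaries V W P = delta V W P ` L_space V W"

text \<open>
  The quotient \<open>H = ker \<delta>\<^sub>P / im \<delta>\<^sub>P\<close> consists of cosets. Its addition is the elementwise sum \<open>+\<close> of
  sets and its zero is \<open>coboundaries V W P\<close> (not the \<open>0\<close> of sets). Adding the coboundaries in
  \<open>coh_scale\<close> matters for the scalar \<open>0\<close> only.
\<close>

definition coh_class ::
  "('k::field, 'v::ab_group_add) gspace \<Rightarrow> ('k, 'w::ab_group_add) gspace \<Rightarrow>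
   (('v \<times> 'w) list \<Rightarrow> 'v \<times> 'w) \<Rightarrow> ('v list \<Rightarrow> 'w) \<Rightarrow> ('v list \<Rightarrow> 'w) set" where
  "coh_class V W P C = C +o coboundaries V W P"

definition H_space ::
  "('k::field, 'v::ab_group_add) gspace \<Rightarrow> ('k, 'w::ab_group_add) gspace \<Rightarrow>
   (('v \<times> 'w) list \<Rightarrow> 'v \<times> 'w) \<Rightarrow> ('v list \<Rightarrow> 'w) set set" where
  "H_space V W P = coh_class V W P ` cocycles V W P"

definition H_hom ::
  "('k::field, 'v::ab_group_add) gspace \<Rightarrow> ('k, 'w::ab_group_add) gspace \<Rightarrow>
   (('v \<times> 'w) list \<Rightarrow> 'v \<times> 'w) \<Rightarrow> nat \<times> deg \<Rightarrow> ('v list \<Rightarrow> 'w) set set" where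
  "H_hom V W P d = coh_class V W P ` (cocycles V W P \<inter> L_hom V W d)"

definition coh_scale ::
  "('k::field, 'v::ab_group_add) gspace \<Rightarrow> ('k, 'w::ab_group_add) gspace \<Rightarrow>
   (('v \<times> 'w) list \<Rightarrow> 'v \<times> 'w) \<Rightarrow> 'k \<Rightarrow> ('v list \<Rightarrow> 'w) set \<Rightarrow> ('v list \<Rightarrow> 'w) set" where
  "coh_scale V W P r A = fscale W r ` A + coboundaries V W P"

definition H_graded ::
  "('k::field, 'v::ab_group_add) gspace \<Rightarrow> ('k, 'w::ab_group_add) gspace \<Rightarrow>
   (('v \<times> 'w) list \<Rightarrow> 'v \<times> 'w) \<Rightarrow> bool" where
  "H_graded V W P \<longleftrightarrow>
     (\<forall>A\<in>H_space V W P. \<exists>!f.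
        (\<forall>d. f d \<in> H_hom V W P d) \<and> finite {d. f d \<noteq> coboundaries V W P} \<and>
        A = coboundaries V W P + (\<Sum>d | f d \<noteq> coboundaries V W P. f d))"

end

theory Submission
  imports Defs
begin

text \<open>
  The map \<open>j(K\<^sub>1)K\<^sub>2\<close> is the signed sum over all ways to contract a segment of the arguments with
  \<open>K\<^sub>1\<close> before \<open>K\<^sub>2\<close> is applied, and everything rests on one combinatorial fact about this operation
  (\<open>j_map_commutator\<close>):
  \<open>j(K\<^sub>1) j(K\<^sub>2) - (-1)\<^bsup>k\<^sub>1k\<^sub>2 + \<langle>\<kappa>\<^sub>1,\<kappa>\<^sub>2\<rangle>\<^esup> j(K\<^sub>2) j(K\<^sub>1) = j([K\<^sub>1, K\<^sub>2]\<^sup>\<Delta>)\<close>. In \<open>j(K\<^sub>1) j(K\<^sub>2) K\<^sub>3\<close> two segments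
  are contracted. Either they are disjoint in the list of arguments, and then the order of the two
  contractions matters only for the sign, so that these terms cancel in the graded commutator; or one
  lies inside the other, and these terms make up \<open>j(j(K\<^sub>1)K\<^sub>2)K\<^sub>3\<close> and \<open>j(j(K\<^sub>2)K\<^sub>1)K\<^sub>3\<close>. The graded Jacobi
  identity (\<open>bracket_hom_jacobi\<close>) is a formal consequence: expand all brackets and apply the commutator
  rule to each of the three pairs.

  Part (1) follows from the Jacobi identity for \<open>P, P, K\<close>, which says
  \<open>2 [P, [P, K]] = [[P, P], K] = 0\<close>, and from an inspection of the multidegrees: a map of first degree
  \<open>1\<close> on \<open>E = V \<oplus> W\<close> takes \<open>V\<close> to \<open>W\<close> and is zero as soon as an argument is in \<open>W\<close>, hence it is the
  extension by zero of a map \<open>V\<^sup>k \<rightarrow> W\<close> (\<open>extV_restrV\<close>). So both \<open>[P, C]\<close> and \<open>[C\<^sub>1, [C\<^sub>2, \<nu>]]\<close> stay in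
  \<open>L(V, W)\<close>. The Hochschild formula (\<open>delta_formula\<close>) is the definition of the bracket written out on
  homogeneous elements of \<open>V\<close>: \<open>P\<close> can be inserted into \<open>C\<close> at \<open>k\<close> places, and \<open>C\<close> into the binary
  \<open>P\<close> at two.

  Part (2) is the Jacobi identity applied twice: \<open>[P, \<cdot>]\<close> is a derivation of the bracket, and
  \<open>[P, \<nu>] = 0\<close> removes the term in which it hits \<open>\<nu>\<close> (\<open>delta_prod_hom\<close>). The derivation rule has a sign
  that depends on the degree of the left factor, so cocycles are first split into homogeneous
  cocycles; this is possible because \<open>\<delta>\<^sub>P\<close> is homogeneous. Then products of cocycles are cocycles,
  products of a cocycle and a coboundary are coboundaries, and the product descends to classes
  (\<open>cup_product\<close>).
\<close>

section \<open>Internal direct sums\<close>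

text \<open>Graded spaces, \<open>M(U)\<close> and \<open>L(V, W)\<close> are all internal direct sums of subgroups of one ambient
  group, which may be larger than the sum; this locale is their common part. It is
  enough to know that \<open>0\<close> has only the trivial decomposition.\<close>

locale direct_family =
  fixes G :: "'d \<Rightarrow> 'a::ab_group_add set"
  assumes zero_mem: "0 \<in> G d"
    and diff_mem: "X \<in> G d \<Longrightarrow> Y \<in> G d \<Longrightarrow> X - Y \<in> G d"
    and independent: "decomposes G 0 f \<Longrightarrow> f = 0"
begin

lemma uminus_mem: "X \<in> G d \<Longrightarrow> - X \<in> G d"
  using diff_mem[OF zero_mem, of X d] by simp

lemma add_mem: "X \<in> G d \<Longrightarrow> Y \<in> G d \<Longrightarrow> X + Y \<in> G d"
  using diff_mem[OF _ uminus_mem, of X d Y] by simp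

lemma sum_mem: "(\<And>i. i \<in> I \<Longrightarrow> f i \<in> G d) \<Longrightarrow> sum f I \<in> G d"
  by (induction I rule: infinite_finite_induct) (auto simp: zero_mem add_mem)

lemma decomposes_iff:
  assumes "finite S" "{d. f d \<noteq> 0} \<subseteq> S"
  shows "decomposes G X f \<longleftrightarrow> (\<forall>d. f d \<in> G d) \<and> X = sum f S"
proof -
  have "sum f {d. f d \<noteq> 0} = sum f S"
    using assms by (intro sum.mono_neutral_left) auto
  then show ?thesis
    using assms finite_subset by (auto simp: decomposes_def)
qed

lemma decomposes_unique:
  assumes "decomposes G X f" "decomposes G X g"
  shows "f = g"
proof -
  let ?S = "{d. f d \<noteq> 0} \<union> {d. g d \<noteq> 0}"
  have S: "finite ?S"
    using assms by (auto simp: decomposes_def)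
  have "X = sum f ?S" "X = sum g ?S" "\<forall>d. f d \<in> G d" "\<forall>d. g d \<in> G d"
    using assms by (auto simp: decomposes_iff[OF S])
  then have "decomposes G 0 (f - g)"
    using diff_mem by (subst decomposes_iff[OF S]) (auto simp: sum_subtractf fun_diff_def)
  then show ?thesis
    using independent by fastforce
qed

lemma component_eq: "decomposes G X f \<Longrightarrow> component G X = f"
  unfolding component_def by (rule the_equality) (auto intro: decomposes_unique)

lemma decomposes_component: "X \<in> dsum G \<Longrightarrow> decomposes G X (component G X)"
  unfolding dsum_def using component_eq by auto

lemma component_mem: "X \<in> dsum G \<Longrightarrow> component G X d \<in> G d"
  using decomposes_component by (auto simp: decomposes_def)

lemma finite_component: "X \<in> dsum G \<Longrightarrow> finite {d. component G X d \<noteq> 0}"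
  using decomposes_component by (auto simp: decomposes_def)

lemma sum_component: "X \<in> dsum G \<Longrightarrow> X = (\<Sum>d | component G X d \<noteq> 0. component G X d)"
  using decomposes_component unfolding decomposes_def by blast

lemma
  assumes "finite S" "\<And>d. d \<in> S \<Longrightarrow> f d \<in> G d"
  shows sum_mem_dsum: "sum f S \<in> dsum G"
    and component_sum: "component G (sum f S) = (\<lambda>d. if d \<in> S then f d else 0)"
proof -
  have "decomposes G (sum f S) (\<lambda>d. if d \<in> S then f d else 0)"
    using assms by (subst decomposes_iff[of S]) (auto simp: zero_mem)
  then show "sum f S \<in> dsum G"
    and "component G (sum f S) = (\<lambda>d. if d \<in> S then f d else 0)"
    by (auto simp: dsum_def intro: component_eq)
qed

lemma hom_mem_dsum: "X \<in> G d \<Longrightarrow> X \<in> dsum G"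
  using sum_mem_dsum[of "{d}" "\<lambda>_. X"] by simp

lemma component_hom: "X \<in> G d \<Longrightarrow> component G X = (\<lambda>e. if e = d then X else 0)"
  using component_sum[of "{d}" "\<lambda>_. X"] by auto

text \<open>Independence of the pieces in the form that is needed when the summands come from another index
  set: if distinct indices give distinct pieces, nothing can cancel.\<close>

lemma sum_eq_zeroD:
  assumes S: "finite S" "inj_on \<tau> S" and f: "\<And>e. e \<in> S \<Longrightarrow> f e \<in> G (\<tau> e)"
    and zero: "sum f S = 0" and e: "e \<in> S"
  shows "f e = 0"
proof -
  let ?g = "\<lambda>d. f (inv_into S \<tau> d)"
  have "sum ?g (\<tau> ` S) = 0"
    using S zero by (simp add: sum.reindex)
  moreover have "component G (sum ?g (\<tau> ` S)) (\<tau> e) = f e"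
    using S f e by (subst component_sum) auto
  moreover have "component G 0 (\<tau> e) = 0"
    using component_sum[of "{}"] by simp
  ultimately show ?thesis by simp
qed

lemma component_diff:
  assumes "X \<in> dsum G" "Y \<in> dsum G"
  shows "component G (X - Y) = component G X - component G Y" and "X - Y \<in> dsum G"
proof -
  let ?S = "{d. component G X d \<noteq> 0} \<union> {d. component G Y d \<noteq> 0}"
  have S: "finite ?S"
    using assms by (simp add: finite_component)
  have "decomposes G (X - Y) (component G X - component G Y)"
    using decomposes_component[OF assms(1)] decomposes_component[OF assms(2)] diff_mem
    by (subst decomposes_iff[OF S]) (auto simp: sum_subtractf decomposes_iff[OF S] fun_diff_def)
  then show "component G (X - Y) = component G X - component G Y" "X - Y \<in> dsum G"
    by (auto simp: dsum_def intro: component_eq)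
qed

lemma zero_mem_dsum: "0 \<in> dsum G"
  using hom_mem_dsum[OF zero_mem] .

lemma component_zero: "component G 0 = 0"
  using component_diff(1)[OF zero_mem_dsum zero_mem_dsum] by simp

lemma uminus_mem_dsum: "X \<in> dsum G \<Longrightarrow> - X \<in> dsum G"
  using component_diff(2)[OF zero_mem_dsum, of X] by simp

lemma add_mem_dsum: "X \<in> dsum G \<Longrightarrow> Y \<in> dsum G \<Longrightarrow> X + Y \<in> dsum G"
  using component_diff(2)[of X "- Y"] uminus_mem_dsum by simp

lemma component_add:
  assumes "X \<in> dsum G" "Y \<in> dsum G"
  shows "component G (X + Y) = component G X + component G Y"
proof -
  have "component G (X + Y) = component G X - component G (- Y)"
    using component_diff(1)[of X "- Y"] assms uminus_mem_dsum by simp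
  also have "component G (- Y) = - component G Y"
    using component_diff(1)[OF zero_mem_dsum, of Y] assms by (simp add: component_zero)
  finally show ?thesis by (simp add: fun_eq_iff)
qed

lemma dsum_induct [consumes 1, case_names zero add]:
  assumes "X \<in> dsum G"
    and "Q 0"
    and "\<And>d Y Z. Y \<in> G d \<Longrightarrow> Z \<in> dsum G \<Longrightarrow> Q Z \<Longrightarrow> Q (Y + Z)"
  shows "Q X"
proof -
  have "sum (component G X) S \<in> dsum G \<and> Q (sum (component G X) S)" if "finite S" for S
    using that
  proof induction
    case (insert d S)
    then show ?case
      using assms(3)[OF component_mem[OF assms(1)], of _ d] component_mem[OF assms(1)]
        sum_mem_dsum[of "insert d S" "component G X"]
      by simp
  qed (use assms zero_mem_dsum in simp_all)
  then show ?thesis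
    using finite_component[OF assms(1)] sum_component[OF assms(1)] by metis
qed

text \<open>Both sides of the equation decompose \<open>\<phi> X\<close> with respect to \<open>H\<close>. Two instances matter: scaling,
  where \<open>\<tau>\<close> is the identity, and the coboundary operator, where \<open>\<tau>\<close> raises the arity by one.\<close>

lemma component_map:
  assumes "direct_family H"
    and add: "\<And>X Y. X \<in> dsum G \<Longrightarrow> Y \<in> dsum G \<Longrightarrow> \<phi> (X + Y) = \<phi> X + \<phi> Y"
    and hom: "\<And>d X. X \<in> G d \<Longrightarrow> \<phi> X \<in> H (\<tau> d)"
    and \<tau>: "inj \<tau>"
    and X: "X \<in> dsum G"
  shows "component H (\<phi> X) (\<tau> d) = \<phi> (component G X d)" and "\<phi> X \<in> dsum H"
proof -
  interpret H: direct_family H by fact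
  have \<phi>0: "\<phi> 0 = 0"
    using add[OF zero_mem_dsum zero_mem_dsum] by simp
  have "\<phi> X \<in> dsum H \<and> (\<forall>d. component H (\<phi> X) (\<tau> d) = \<phi> (component G X d))"
    using X
  proof (induction rule: dsum_induct)
    case zero
    then show ?case
      by (simp add: \<phi>0 H.zero_mem_dsum component_zero H.component_zero)
  next
    case (add e Y Z)
    have Y: "Y \<in> dsum G"
      by (rule hom_mem_dsum[OF add(1)])
    have \<phi>Y: "\<phi> Y \<in> dsum H"
      by (rule H.hom_mem_dsum[OF hom[OF add(1)]])
    have "component H (\<phi> Y) (\<tau> d) = \<phi> (component G Y d)" for d
      using \<tau> by (auto simp: component_hom[OF add(1)] H.component_hom[OF hom[OF add(1)]] \<phi>0 inj_eq)
    then show ?case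
      using add Y \<phi>Y assms(2) component_mem hom_mem_dsum
      by (simp add: component_add H.component_add H.add_mem_dsum)
        (metis component_mem hom_mem_dsum)
  qed
  then show "component H (\<phi> X) (\<tau> d) = \<phi> (component G X d)" and "\<phi> X \<in> dsum H"
    by auto
qed

text \<open>The next lemmas concern maps that are defined on homogeneous elements and extended by summing
  over the nonzero components, such as the bracket and \<open>\<rho>\<close>. The supports of \<open>X\<close>, \<open>Y\<close> and \<open>X + Y\<close>
  differ, so additivity is proved by summing over a common finite index set; the extra summands
  vanish.\<close>

lemma extension_cong:
  assumes "X \<in> dsum G" "finite S" "{d. component G X d \<noteq> 0} \<subseteq> S" "\<And>d. b d 0 = (0::'b::ab_group_add)"
  shows "(\<Sum>d | component G X d \<noteq> 0. b d (component G X d)) = (\<Sum>d\<in>S. b d (component G X d))"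
  using assms by (intro sum.mono_neutral_left) auto

lemma extension_add:
  fixes b :: "'d \<Rightarrow> 'a \<Rightarrow> 'b::ab_group_add"
  assumes b: "\<And>d X Y. X \<in> G d \<Longrightarrow> Y \<in> G d \<Longrightarrow> b d (X + Y) = b d X + b d Y"
    and X: "X \<in> dsum G" and Y: "Y \<in> dsum G"
  shows "(\<Sum>d | component G (X + Y) d \<noteq> 0. b d (component G (X + Y) d)) =
    (\<Sum>d | component G X d \<noteq> 0. b d (component G X d)) +
    (\<Sum>d | component G Y d \<noteq> 0. b d (component G Y d))"
proof -
  let ?S = "{d. component G X d \<noteq> 0} \<union> {d. component G Y d \<noteq> 0}"
  have S: "finite ?S"
    using X Y by (simp add: finite_component)
  have b0: "b d 0 = 0" for d
    using b[OF zero_mem zero_mem, of d] by simp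
  have "{d. component G (X + Y) d \<noteq> 0} \<subseteq> ?S"
    using X Y by (auto simp: component_add)
  then have "(\<Sum>d | component G (X + Y) d \<noteq> 0. b d (component G (X + Y) d)) =
      (\<Sum>d\<in>?S. b d (component G X d + component G Y d))"
    using extension_cong[of "X + Y" ?S b] X Y S by (simp add: add_mem_dsum component_add b0)
  also have "\<dots> = (\<Sum>d\<in>?S. b d (component G X d)) + (\<Sum>d\<in>?S. b d (component G Y d))"
    using X Y by (simp add: component_mem b sum.distrib)
  finally show ?thesis
    using extension_cong[of X ?S b] extension_cong[of Y ?S b] X Y S by (simp add: b0)
qed

lemma extension_map:
  fixes b :: "'d \<Rightarrow> 'a \<Rightarrow> 'b::ab_group_add"
  assumes b: "\<And>d. b d 0 = 0"
    and \<psi>: "\<psi> 0 = 0" "\<And>A B. \<psi> (A + B) = \<psi> A + \<psi> B"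
    and eq: "\<And>d X. X \<in> G d \<Longrightarrow> b d (\<phi> X) = \<psi> (b d X)"
    and \<phi>: "\<And>X Y. X \<in> dsum G \<Longrightarrow> Y \<in> dsum G \<Longrightarrow> \<phi> (X + Y) = \<phi> X + \<phi> Y"
    "\<And>d X. X \<in> G d \<Longrightarrow> \<phi> X \<in> G d"
    and X: "X \<in> dsum G"
  shows "(\<Sum>d | component G (\<phi> X) d \<noteq> 0. b d (component G (\<phi> X) d)) =
    \<psi> (\<Sum>d | component G X d \<noteq> 0. b d (component G X d))"
proof -
  let ?S = "{d. component G X d \<noteq> 0}"
  have S: "finite ?S"
    using X by (simp add: finite_component)
  have \<phi>0: "\<phi> 0 = 0"
    using \<phi>(1)[OF zero_mem_dsum zero_mem_dsum] by simp
  have c: "component G (\<phi> X) d = \<phi> (component G X d)" "\<phi> X \<in> dsum G" for d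
    using component_map[where H=G and \<phi>=\<phi> and \<tau>="\<lambda>d. d" and X=X] \<phi> X direct_family_axioms by auto
  have "\<psi> (sum f S) = (\<Sum>d\<in>S. \<psi> (f d))" for f :: "'d \<Rightarrow> 'b" and S
    by (induction S rule: infinite_finite_induct) (auto simp: \<psi>)
  moreover have "(\<Sum>d | component G (\<phi> X) d \<noteq> 0. b d (component G (\<phi> X) d)) =
      (\<Sum>d\<in>?S. b d (component G (\<phi> X) d))"
    using c \<phi>0 b S by (intro extension_cong) auto
  ultimately show ?thesis
    using c eq component_mem[OF X] by simp
qed

lemma extension_hom:
  assumes "X \<in> G d" "b d 0 = (0::'b::ab_group_add)"
  shows "(\<Sum>e | component G X e \<noteq> 0. b e (component G X e)) = b d X"
proof (cases "X = 0")
  case True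
  then show ?thesis using assms by (simp add: component_zero)
next
  case False
  then have "{e. component G X e \<noteq> 0} = {d}"
    using assms by (auto simp: component_hom)
  then show ?thesis using assms by (simp add: component_hom)
qed

end

section \<open>Signs\<close>

text \<open>Only the parity of an exponent of \<open>-1\<close> matters, so an identity between signs is a congruence
  modulo \<open>2\<close> between integer polynomials.\<close>

lemma sign_eqI: "even (a - b) \<Longrightarrow> (-1) powi a = ((-1) powi b :: 'k::field)"
  by (auto simp: power_int_minus_left)

lemma sign_cases: "(-1) powi a = (1 :: 'k::field) \<or> (-1) powi a = (-1 :: 'k::field)"
  by (auto simp: power_int_minus_left)

lemma sign_add: "(-1) powi (a + b) = ((-1) powi a * (-1) powi b :: 'k::field)"
  by (simp add: power_int_add)

lemma deg_inner_add_left: "deg_inner m (x + y) z = deg_inner m x z + deg_inner m y z"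
  by (simp add: deg_inner_def sum.distrib algebra_simps)

lemma deg_inner_add_right: "deg_inner m z (x + y) = deg_inner m z x + deg_inner m z y"
  by (simp add: deg_inner_def sum.distrib algebra_simps)

lemma deg_inner_zero [simp]: "deg_inner m 0 z = 0" "deg_inner m z 0 = 0"
  by (simp_all add: deg_inner_def)

lemma deg_inner_commute: "deg_inner m x y = deg_inner m y x"
  by (simp add: deg_inner_def mult.commute)

section \<open>Graded spaces\<close>

locale graded =
  fixes U :: "('k::field, 'a::ab_group_add) gspace"
  assumes graded: "graded_space (grank U) U"

sublocale graded \<subseteq> vector_space "gscale U"
  using graded by (simp add: graded_space_def)

sublocale graded \<subseteq> direct_family "gpiece U"
proof
  have sub: "subspace (gpiece U x)" for x
    using graded by (simp add: graded_space_def)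
  show "0 \<in> gpiece U x" for x
    using sub subspace_0 by blast
  show "X \<in> gpiece U x \<Longrightarrow> Y \<in> gpiece U x \<Longrightarrow> X - Y \<in> gpiece U x" for X Y x
    using sub subspace_diff by blast
  have "decomposes (gpiece U) 0 (0 :: deg \<Rightarrow> 'a)"
    using sub subspace_0 by (auto simp: decomposes_def)
  then show "f = 0" if "decomposes (gpiece U) 0 f" for f
    using that graded by (metis graded_space_def)
qed

context graded
begin

lemma piece_scale: "X \<in> gpiece U x \<Longrightarrow> gscale U r X \<in> gpiece U x"
  using graded subspace_scale by (auto simp: graded_space_def)

lemma in_dsum [simp]: "X \<in> dsum (gpiece U)"
  using graded by (auto simp: graded_space_def dsum_def)

lemma component_scale: "component (gpiece U) (gscale U r X) d = gscale U r (component (gpiece U) X d)"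
  using component_map(1)[where H="gpiece U" and \<phi>="gscale U r" and \<tau>="\<lambda>d. d"] direct_family_axioms
  by (simp add: scale_right_distrib piece_scale)

end

section \<open>Multilinear maps\<close>

lemma multilinear_length: "multilinear s t p f \<Longrightarrow> length Xs \<noteq> p \<Longrightarrow> f Xs = 0"
  by (simp add: multilinear_def)

lemma multilinear_slot:
  assumes "multilinear s t p f" "length L + length R + 1 = p"
  shows "Vector_Spaces.linear s t (\<lambda>X. f (L @ X # R))"
proof -
  have "Vector_Spaces.linear s t (\<lambda>X. f ((L @ 0 # R)[length L := X]))"
    using assms unfolding multilinear_def by (elim conjE allE[of _ "L @ 0 # R"] allE[of _ "length L"]) auto
  then show ?thesis by simp
qed

lemma
  assumes "multilinear s t p f"
  shows multilinear_add: "f (L @ (X + Y) # R) = f (L @ X # R) + f (L @ Y # R)"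
    and multilinear_scale: "vector_space t \<Longrightarrow> f (L @ s r X # R) = t r (f (L @ X # R))"
proof -
  show "f (L @ (X + Y) # R) = f (L @ X # R) + f (L @ Y # R)"
    using multilinear_slot[OF assms, of L R] multilinear_length[OF assms]
    by (cases "length L + length R + 1 = p") (auto simp: Vector_Spaces.linear_iff)
  have "t r 0 = 0" if "vector_space t"
    using that vector_space_def module.scale_zero_right by (metis module_iff_vector_space)
  then show "f (L @ s r X # R) = t r (f (L @ X # R))" if "vector_space t"
    using multilinear_slot[OF assms, of L R] multilinear_length[OF assms] that
    by (cases "length L + length R + 1 = p") (auto simp: Vector_Spaces.linear_iff)
qed

lemma multilinear_zero:
  assumes "multilinear s t p f"
  shows "f (L @ 0 # R) = 0"
  using multilinear_add[OF assms, of L 0 0 R] by simp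

lemma multilinear_zero_entry:
  assumes "multilinear s t p f" "0 \<in> set Xs"
  shows "f Xs = 0"
  using assms multilinear_zero by (metis split_list)

lemma multilinear_sum:
  assumes "multilinear s t p f"
  shows "f (L @ sum g I # R) = (\<Sum>i\<in>I. f (L @ g i # R))"
  by (induction I rule: infinite_finite_induct)
    (auto simp: multilinear_zero[OF assms] multilinear_add[OF assms])

text \<open>A slot is addressed by splitting the list of arguments around it, which is more convenient than
  updating the list at an index when arguments are inserted and deleted.\<close>

lemma multilinearI:
  assumes "vector_space s" "vector_space t"
    and "\<And>Xs. length Xs \<noteq> p \<Longrightarrow> f Xs = 0"
    and "\<And>L X Y R. length L + length R + 1 = p \<Longrightarrow>
      f (L @ (X + Y) # R) = f (L @ X # R) + f (L @ Y # R)"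
    and "\<And>L X r R. length L + length R + 1 = p \<Longrightarrow> f (L @ s r X # R) = t r (f (L @ X # R))"
  shows "multilinear s t p f"
  unfolding multilinear_def
proof (intro conjI allI impI)
  fix Xs :: "'b list" and i assume "length Xs = p" "i < p"
  then have "length (take i Xs) + length (drop (Suc i) Xs) + 1 = p"
    "\<And>X. Xs[i := X] = take i Xs @ X # drop (Suc i) Xs"
    by (auto simp: upd_conv_take_nth_drop)
  then show "Vector_Spaces.linear s t (\<lambda>X. f (Xs[i := X]))"
    unfolding Vector_Spaces.linear_iff using assms by metis
qed (use assms in auto)

lemma homogeneous_list_length: "homogeneous_list U xs Xs \<Longrightarrow> length xs = length Xs"
  by (simp add: homogeneous_list_def list_all2_lengthD)

lemma homogeneous_list_Nil [simp]: "homogeneous_list U [] []"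
  by (simp add: homogeneous_list_def)

lemma homogeneous_list_Cons [simp]:
  "homogeneous_list U (x # xs) (X # Xs) \<longleftrightarrow> X \<in> gpiece U x \<and> homogeneous_list U xs Xs"
  by (simp add: homogeneous_list_def)

lemma homogeneous_list_append:
  "homogeneous_list U xs Xs \<Longrightarrow> homogeneous_list U ys Ys \<Longrightarrow> homogeneous_list U (xs @ ys) (Xs @ Ys)"
  by (simp add: homogeneous_list_def list_all2_appendI)

lemma homogeneous_list_take: "homogeneous_list U xs Xs \<Longrightarrow> homogeneous_list U (take i xs) (take i Xs)"
  by (simp add: homogeneous_list_def list_all2_takeI)

lemma homogeneous_list_drop: "homogeneous_list U xs Xs \<Longrightarrow> homogeneous_list U (drop i xs) (drop i Xs)"
  by (simp add: homogeneous_list_def list_all2_dropI)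

text \<open>The setting of multilinear maps from one graded space to another over the same field. Maps from
  \<open>U\<close> to itself are the instance \<open>self\<close> below.\<close>

locale graded_pair = U: graded U + U': graded U'
  for U :: "('k::field, 'a::ab_group_add) gspace" and U' :: "('k, 'b::ab_group_add) gspace"
begin

abbreviation multilin :: "nat \<Rightarrow> ('a list \<Rightarrow> 'b) \<Rightarrow> bool" where
  "multilin \<equiv> multilinear (gscale U) (gscale U')"

lemma multilin_scale: "multilin p f \<Longrightarrow> f (L @ gscale U r X # R) = gscale U' r (f (L @ X # R))"
  using multilinear_scale U'.vector_space_axioms by blast

lemma multilinI:
  assumes "\<And>Xs. length Xs \<noteq> p \<Longrightarrow> f Xs = 0"
    and "\<And>L X Y R. length L + length R + 1 = p \<Longrightarrow>
      f (L @ (X + Y) # R) = f (L @ X # R) + f (L @ Y # R)"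
    and "\<And>L X r R. length L + length R + 1 = p \<Longrightarrow>
      f (L @ gscale U r X # R) = gscale U' r (f (L @ X # R))"
  shows "multilin p f"
  using assms U.vector_space_axioms U'.vector_space_axioms by (intro multilinearI)

lemma multilin_0: "multilin p 0"
  by (rule multilinI) auto

lemma multilin_diff: "multilin p f \<Longrightarrow> multilin p g \<Longrightarrow> multilin p (f - g)"
  by (rule multilinI)
    (auto simp: multilinear_length multilinear_add multilin_scale U'.scale_right_diff_distrib)

lemma multilin_fscale: "multilin p f \<Longrightarrow> multilin p (fscale U' r f)"
  by (rule multilinI)
    (auto simp: fscale_def multilinear_length multilinear_add multilin_scale
      U'.scale_right_distrib mult.commute)

text \<open>Every entry of the argument is a sum of homogeneous elements, so the homogeneous arguments
  determine a multilinear map.\<close>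

lemma multilin_eq_0I:
  assumes f: "multilin p f"
    and hom: "\<And>xs Xs. length xs = p \<Longrightarrow> homogeneous_list U xs Xs \<Longrightarrow> f Xs = 0"
  shows "f = 0"
proof -
  have "homogeneous_list U xs Xs \<Longrightarrow> f (L @ Xs) = 0" for L Xs xs
  proof (induction L arbitrary: Xs xs rule: rev_induct)
    case Nil
    then show ?case
      using hom multilinear_length[OF f] homogeneous_list_length by fastforce
  next
    case (snoc X L)
    have "f (L @ X # Xs) = 0"
      using U.in_dsum[of X]
    proof (induction rule: U.dsum_induct)
      case (add d Y Z)
      then have "f (L @ Y # Xs) = 0"
        using snoc.IH[of "d # xs"] snoc.prems by simp
      then show ?case
        using add by (simp add: multilinear_add[OF f])
    qed (rule multilinear_zero[OF f])
    then show ?case by simp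
  qed
  from this[of "[]" "[]"] this show ?thesis
    using homogeneous_list_Nil by (metis append_Nil2 ext zero_fun_apply)
qed

lemma multilin_eqI:
  assumes "multilin p f" "multilin p g"
    and "\<And>xs Xs. length xs = p \<Longrightarrow> homogeneous_list U xs Xs \<Longrightarrow> f Xs = g Xs"
  shows "f = g"
  using multilin_eq_0I[OF multilin_diff[OF assms(1,2)]] assms(3) by simp

lemma mlin_multilin: "f \<in> mlin U U' p c \<Longrightarrow> multilin p f"
  by (simp add: mlin_def)

lemma mlin_hom:
  "f \<in> mlin U U' p c \<Longrightarrow> homogeneous_list U xs Xs \<Longrightarrow> length xs = p \<Longrightarrow> f Xs \<in> gpiece U' (sum_list xs + c)"
  by (auto simp: mlin_def)

lemma mlin_0: "0 \<in> mlin U U' p c"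
  by (auto simp: mlin_def multilin_0 U'.zero_mem)

lemma mlin_diff: "f \<in> mlin U U' p c \<Longrightarrow> g \<in> mlin U U' p c \<Longrightarrow> f - g \<in> mlin U U' p c"
  by (auto simp: mlin_def multilin_diff U'.diff_mem)

lemma mlin_fscale: "f \<in> mlin U U' p c \<Longrightarrow> fscale U' r f \<in> mlin U U' p c"
  by (simp add: mlin_def multilin_fscale) (simp add: fscale_def U'.piece_scale)

text \<open>Evaluation on homogeneous arguments of degrees \<open>xs\<close> sends the maps of weight \<open>c\<close> to the piece
  of degree \<open>sum_list xs + c\<close>. Distinct weights give distinct pieces, so a vanishing sum of
  multilinear maps vanishes termwise.\<close>

lemma direct_family_mlin:
  assumes H: "\<And>d. H d \<subseteq> mlin U U' (p d) (c d)" "\<And>d. 0 \<in> H d"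
    "\<And>d f g. f \<in> H d \<Longrightarrow> g \<in> H d \<Longrightarrow> f - g \<in> H d"
    and inj: "\<And>d e f g. f \<in> H d \<Longrightarrow> g \<in> H e \<Longrightarrow> f \<noteq> 0 \<Longrightarrow> g \<noteq> 0 \<Longrightarrow> p d = p e \<Longrightarrow> c d = c e \<Longrightarrow> d = e"
  shows "direct_family H"
proof
  fix f assume "decomposes H 0 f"
  then have f: "f d \<in> H d" and S: "finite {d. f d \<noteq> 0}" and zero: "(\<Sum>d | f d \<noteq> 0. f d) = 0" for d
    by (auto simp: decomposes_def)
  have mult: "multilin (p d) (f d)" for d
    using f H(1) mlin_multilin by blast
  show "f = 0"
  proof (rule ccontr)
    assume "f \<noteq> 0"
    then obtain d where d: "f d \<noteq> 0" by (auto simp: fun_eq_iff)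
    have "f d = 0"
      using mult
    proof (rule multilin_eq_0I)
      fix xs Xs assume xs: "length xs = p d" "homogeneous_list U xs Xs"
      let ?S = "{e. f e \<noteq> 0 \<and> p e = p d}"
      have "(\<Sum>e\<in>?S. f e Xs) = (\<Sum>e | f e \<noteq> 0. f e Xs)"
        using S xs multilinear_length[OF mult] homogeneous_list_length[OF xs(2)]
        by (intro sum.mono_neutral_left) auto
      also have "\<dots> = (\<Sum>e | f e \<noteq> 0. f e) Xs"
        using S by (induction rule: finite_induct) auto
      finally have "(\<Sum>e\<in>?S. f e Xs) = 0"
        using zero by simp
      moreover have "f e Xs \<in> gpiece U' (sum_list xs + c e)" if "e \<in> ?S" for e
        using mlin_hom[OF subsetD[OF H(1) f] xs(2)] that xs(1) by auto
      moreover have "inj_on (\<lambda>e. sum_list xs + c e) ?S"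
        by (intro inj_onI inj[OF f f]) auto
      ultimately show "f d Xs = 0"
        using S d U'.sum_eq_zeroD[of ?S "\<lambda>e. sum_list xs + c e" "\<lambda>e. f e Xs" d] by auto
    qed
    then show False using d by simp
  qed
qed (use H in auto)

text \<open>Extending a family \<open>\<phi> xs\<close> of multilinear maps, one for each tuple of degrees, from
  homogeneous arguments to all arguments. Only finitely many tuples contribute, and the sum may
  run over any finite box that contains the supports of the arguments.\<close>

context
  fixes p :: nat and \<phi> :: "deg list \<Rightarrow> 'a list \<Rightarrow> 'b"
  assumes \<phi>: "\<And>xs. length xs = p \<Longrightarrow> multilin p (\<phi> xs)"
    and \<phi>_length: "\<And>xs Xs. length Xs \<noteq> p \<Longrightarrow> \<phi> xs Xs = 0"
begin

definition extension :: "'a list \<Rightarrow> 'b" where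
  "extension Xs = (\<Sum>xs | list_all2 (\<lambda>x X. component (gpiece U) X x \<noteq> 0) xs Xs.
      \<phi> xs (map2 (\<lambda>x X. component (gpiece U) X x) xs Xs))"

lemma extension_box:
  assumes S: "finite S" "\<And>X. X \<in> set Xs \<Longrightarrow> {x. component (gpiece U) X x \<noteq> 0} \<subseteq> S"
    and len: "length Xs = p"
  shows "extension Xs = (\<Sum>xs | set xs \<subseteq> S \<and> length xs = p.
      \<phi> xs (map2 (\<lambda>x X. component (gpiece U) X x) xs Xs))"
  unfolding extension_def
proof (rule sum.mono_neutral_left)
  show "{xs. list_all2 (\<lambda>x X. component (gpiece U) X x \<noteq> 0) xs Xs} \<subseteq> {xs. set xs \<subseteq> S \<and> length xs = p}"
    using S(2) len by (fastforce simp: list_all2_conv_all_nth in_set_conv_nth)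
  have "\<phi> xs (map2 (\<lambda>x X. component (gpiece U) X x) xs Xs) = 0"
    if "length xs = p" "\<not> list_all2 (\<lambda>x X. component (gpiece U) X x \<noteq> 0) xs Xs" for xs
  proof -
    obtain i where "i < p" "component (gpiece U) (Xs ! i) (xs ! i) = 0"
      using \<open>\<not> list_all2 _ xs Xs\<close> \<open>length xs = p\<close> len by (auto simp: list_all2_conv_all_nth)
    then have "map2 (\<lambda>x X. component (gpiece U) X x) xs Xs ! i = 0"
      using that(1) len by simp
    then have "0 \<in> set (map2 (\<lambda>x X. component (gpiece U) X x) xs Xs)"
      using \<open>i < p\<close> that(1) len nth_mem[of i "map2 (\<lambda>x X. component (gpiece U) X x) xs Xs"] by simp
    then show ?thesis
      using multilinear_zero_entry[OF \<phi>[OF that(1)]] by blast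
  qed
  then show "\<forall>xs\<in>{xs. set xs \<subseteq> S \<and> length xs = p} -
      {xs. list_all2 (\<lambda>x X. component (gpiece U) X x \<noteq> 0) xs Xs}.
      \<phi> xs (map2 (\<lambda>x X. component (gpiece U) X x) xs Xs) = 0"
    by auto
qed (use S in \<open>simp add: finite_lists_length_eq\<close>)

lemma multilin_extension: "multilin p extension"
proof (rule multilinI)
  fix Xs :: "'a list" assume "length Xs \<noteq> p"
  then show "extension Xs = 0"
    unfolding extension_def by (intro sum.neutral) (auto simp: \<phi>_length list_all2_lengthD)
next
  fix L R :: "'a list" assume len: "length L + length R + 1 = p"
  let ?c = "component (gpiece U)"
  let ?m = "map2 (\<lambda>x X. ?c X x)"
  define S where "S X Y = (\<Union>Z\<in>set (L @ X # Y # R). {x. ?c Z x \<noteq> 0})" for X Y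
  have finS: "finite (S X Y)" for X Y
    unfolding S_def using U.finite_component[OF U.in_dsum] by blast
  have box: "extension (L @ Z # R) = (\<Sum>xs | set xs \<subseteq> S X Y \<and> length xs = p. \<phi> xs (?m xs (L @ Z # R)))"
    if "{x. ?c Z x \<noteq> 0} \<subseteq> S X Y" for X Y Z
    using that len finS by (intro extension_box) (auto simp: S_def)
  have split: "\<exists>l r x. \<forall>Z. ?m xs (L @ Z # R) = l @ ?c Z x # r" if "length xs = p" for xs
  proof -
    have "xs = take (length L) xs @ xs ! length L # drop (Suc (length L)) xs"
      using len that by (intro id_take_nth_drop) simp
    moreover have "length (take (length L) xs) = length L"
      using len that by simp
    ultimately obtain l x r where "xs = l @ x # r" "length l = length L" by blast
    then have "?m xs (L @ Z # R) = ?m l L @ ?c Z x # ?m r R" for Z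
      by simp
    then show ?thesis by blast
  qed
  have cS: "{x. ?c X x \<noteq> 0} \<subseteq> S X Y" "{x. ?c Y x \<noteq> 0} \<subseteq> S X Y" for X Y
    by (auto simp: S_def)
  show "extension (L @ (X + Y) # R) = extension (L @ X # R) + extension (L @ Y # R)" for X Y
  proof -
    have "{x. ?c (X + Y) x \<noteq> 0} \<subseteq> S X Y"
      by (auto simp: S_def U.component_add)
    moreover have "\<phi> xs (?m xs (L @ (X + Y) # R)) = \<phi> xs (?m xs (L @ X # R)) + \<phi> xs (?m xs (L @ Y # R))"
      if "length xs = p" for xs
      using split[OF that] multilinear_add[OF \<phi>[OF that]]
      by (auto simp: U.component_add)
    ultimately show ?thesis
      using cS by (simp add: box[of _ X Y] sum.distrib)
  qed
  show "extension (L @ gscale U r X # R) = gscale U' r (extension (L @ X # R))" for X r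
  proof -
    have "{x. ?c (gscale U r X) x \<noteq> 0} \<subseteq> S X X"
      by (auto simp: S_def U.component_scale)
    moreover have "\<phi> xs (?m xs (L @ gscale U r X # R)) = gscale U' r (\<phi> xs (?m xs (L @ X # R)))"
      if "length xs = p" for xs
      using split[OF that] multilin_scale[OF \<phi>[OF that]]
      by (auto simp: U.component_scale)
    ultimately show ?thesis
      using cS by (simp add: box[of _ X X] U'.scale_sum_right)
  qed
qed

text \<open>For homogeneous arguments different from \<open>0\<close> a single tuple of degrees contributes, namely the
  given one. If some argument is \<open>0\<close>, its degree is ambiguous and no tuple contributes at all, but
  then both sides vanish.\<close>

lemma extension_homogeneous:
  assumes Xs: "homogeneous_list U xs Xs" and len: "length xs = p"
  shows "extension Xs = \<phi> xs Xs"
proof (cases "0 \<in> set Xs")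
  case True
  then obtain i where "i < length Xs" "Xs ! i = 0"
    by (auto simp: in_set_conv_nth)
  then have "{xs. list_all2 (\<lambda>x X. component (gpiece U) X x \<noteq> 0) xs Xs} = {}"
    by (auto simp: list_all2_conv_all_nth U.component_zero)
  then show ?thesis
    using multilinear_zero_entry[OF \<phi>[OF len] True] by (simp add: extension_def)
next
  case False
  have c: "component (gpiece U) (Xs ! i) = (\<lambda>y. if y = xs ! i then Xs ! i else 0)" if "i < length Xs" for i
    using Xs that U.component_hom by (auto simp: homogeneous_list_def list_all2_conv_all_nth)
  have nz: "Xs ! i \<noteq> 0" if "i < length Xs" for i
    using False that by (metis nth_mem)
  have "{ys. list_all2 (\<lambda>x X. component (gpiece U) X x \<noteq> 0) ys Xs} = {xs}"
    using homogeneous_list_length[OF Xs]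
    by (auto simp: list_all2_conv_all_nth c nz intro!: nth_equalityI split: if_splits)
  moreover have "map2 (\<lambda>x X. component (gpiece U) X x) xs Xs = Xs"
    using homogeneous_list_length[OF Xs] by (auto intro!: nth_equalityI simp: c)
  ultimately show ?thesis
    by (simp add: extension_def)
qed

end

end

sublocale graded_pair \<subseteq> L: direct_family "L_hom U U'"
  by (rule direct_family_mlin[where p=fst and c=snd]) (auto simp: L_hom_def mlin_0 mlin_diff)

sublocale graded \<subseteq> self: graded_pair U U
  by unfold_locales

text \<open>For \<open>k < -1\<close> the arity \<open>nat (k + 1)\<close> coincides with that of \<open>k = -1\<close>, but there the space is zero,
  so arity and weight still determine the index of a nonzero map.\<close>

sublocale graded \<subseteq> M: direct_family "M_hom U"
  by (rule self.direct_family_mlin[where p="\<lambda>d. nat (fst d + 1)" and c=snd])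
    (auto simp: M_hom_def self.mlin_0 self.mlin_diff split: if_splits)

section \<open>Contracting a segment of a list\<close>

text \<open>Inserting \<open>K\<^sub>1\<close> into \<open>K\<^sub>2\<close> is composition with \<open>contract\<close>. The operation is polymorphic on purpose:
  contracting the list of degrees with \<open>total_degree\<close> yields the degrees of the contracted list.\<close>

definition contract :: "nat \<Rightarrow> ('a list \<Rightarrow> 'a) \<Rightarrow> nat \<Rightarrow> 'a list \<Rightarrow> 'a list" where
  "contract a F i Xs = take i Xs @ F (take a (drop i Xs)) # drop (i + a) Xs"

abbreviation (input) total_degree :: "deg \<Rightarrow> deg list \<Rightarrow> deg" where
  "total_degree \<kappa> xs \<equiv> sum_list xs + \<kappa>"

lemma contract_append:
  "length A = i \<Longrightarrow> length B = a \<Longrightarrow> contract a F i (A @ B @ C) = A @ F B # C"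
  by (simp add: contract_def)

lemma length_contract: "i + a \<le> length Xs \<Longrightarrow> length (contract a F i Xs) + a = length Xs + 1"
  by (simp add: contract_def)

lemma split_list_at:
  assumes "i \<le> length Xs"
  obtains A B where "Xs = A @ B" "length A = i"
  using assms by (metis append_take_drop_id length_take min.absorb2)

text \<open>Decompose the list as \<open>p @ q @ r @ s @ t\<close> with the segments \<open>q\<close> (for \<open>B\<close>) and \<open>s\<close> (for \<open>A\<close>). The
  position of \<open>s\<close> depends on whether \<open>q\<close>, of length \<open>b\<close>, has already become a single entry.\<close>

lemma contract_contract_disjoint:
  assumes "l + b + m + a \<le> length Xs"
  shows "contract b B l (contract a A (l + b + m) Xs) = contract a A (l + 1 + m) (contract b B l Xs)"
proof -
  obtain p X1 where 1: "Xs = p @ X1" "length p = l"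
    using split_list_at[of l Xs] assms by auto
  obtain q X2 where 2: "X1 = q @ X2" "length q = b"
    using split_list_at[of b X1] assms 1 by auto
  obtain r X3 where 3: "X2 = r @ X3" "length r = m"
    using split_list_at[of m X2] assms 1 2 by auto
  obtain s t where 4: "X3 = s @ t" "length s = a"
    using split_list_at[of a X3] assms 1 2 3 by auto
  have "contract a A (l + b + m) Xs = p @ q @ r @ A s # t"
    using contract_append[of "p @ q @ r" "l + b + m" s a A t] 1 2 3 4 by simp
  moreover have "contract a A (l + 1 + m) (p @ B q # r @ s @ t) = p @ B q # r @ A s # t"
    using contract_append[of "p @ B q # r" "l + 1 + m" s a A t] 1 2 3 4 by simp
  ultimately show ?thesis
    using 1 2 3 4 contract_append[of p l q b] by simp
qed

text \<open>Here the segment for \<open>B\<close> contains the entry that \<open>A\<close> has produced, so that before the first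
  contraction it has \<open>a + b - 1\<close> entries.\<close>

lemma contract_contract_nested:
  assumes "i < b" "l + a + b \<le> length Xs + 1"
  shows "contract b B l (contract a A (l + i) Xs) = contract (a + b - 1) (\<lambda>Z. B (contract a A i Z)) l Xs"
proof -
  obtain p X1 where 1: "Xs = p @ X1" "length p = l"
    using split_list_at[of l Xs] assms by auto
  obtain q X2 where 2: "X1 = q @ X2" "length q = i"
    using split_list_at[of i X1] assms 1 by auto
  obtain r X3 where 3: "X2 = r @ X3" "length r = a"
    using split_list_at[of a X2] assms 1 2 by auto
  have "b - i - 1 \<le> length X3"
    using assms 1 2 3 by simp
  then obtain s t where 4: "X3 = s @ t" "length s = b - i - 1"
    by (rule split_list_at)
  have "contract a A (l + i) Xs = p @ (q @ A r # s) @ t"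
    using contract_append[of "p @ q" "l + i" r a A "s @ t"] 1 2 3 4 by simp
  moreover have "contract b B l (p @ (q @ A r # s) @ t) = p @ B (q @ A r # s) # t"
    using 1 2 3 4 assms by (intro contract_append) auto
  moreover have "contract (a + b - 1) (\<lambda>Z. B (contract a A i Z)) l (p @ (q @ r @ s) @ t) =
      p @ B (contract a A i (q @ r @ s)) # t"
    using 1 2 3 4 assms by (intro contract_append) auto
  moreover have "contract a A i (q @ r @ s) = q @ A r # s"
    using 2 3 by (intro contract_append)
  ultimately show ?thesis
    using 1 2 3 4 by simp
qed

lemma take_contract: "l \<le> i \<Longrightarrow> i \<le> length Xs \<Longrightarrow> take l (contract a F i Xs) = take l Xs"
  by (simp add: contract_def min_def)

lemma sum_list_contract:
  assumes "i + a \<le> length xs"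
  shows "sum_list (contract a (total_degree \<kappa>) i xs) = sum_list xs + \<kappa>"
proof -
  obtain p ys where 1: "xs = p @ ys" "length p = i"
    using split_list_at[of i xs] assms by auto
  obtain q r where 2: "ys = q @ r" "length q = a"
    using split_list_at[of a ys] assms 1 by auto
  show ?thesis
    using 1 2 by (simp add: contract_append algebra_simps)
qed

lemma sum_list_take_contract:
  assumes "l + b + m \<le> length xs"
  shows "sum_list (take (l + 1 + m) (contract b (total_degree \<kappa>) l xs)) = sum_list (take (l + b + m) xs) + \<kappa>"
proof -
  obtain p ys where 1: "xs = p @ ys" "length p = l"
    using split_list_at[of l xs] assms by auto
  obtain q r where 2: "ys = q @ r" "length q = b"
    using split_list_at[of b ys] assms 1 by auto
  show ?thesis
    using 1 2 by (simp add: contract_append algebra_simps)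
qed

text \<open>Every entry of a list either survives a contraction or lies in the contracted segment. Hence
  inserting a multilinear map into a multilinear map gives a multilinear map.\<close>

lemma contract_slot:
  fixes F :: "'a list \<Rightarrow> 'a"
  assumes "i + a \<le> length L + length R + 1"
  obtains (outside) L' R' where "\<And>X. contract a F i (L @ X # R) = L' @ X # R'"
  | (inside) L' L'' R'' R' where "\<And>X. contract a F i (L @ X # R) = L' @ F (L'' @ X # R'') # R'"
proof -
  consider (before) "i + a \<le> length L" | (after) "length L < i" | (mid) "i \<le> length L" "length L < i + a"
    by linarith
  then show thesis
  proof cases
    case before
    then show thesis
      using outside[of "take i L @ F (take a (drop i L)) # drop (i + a) L" R]
      by (simp add: contract_def)
  next
    case after
    define j where "j = i - length L - 1"
    have "i = length L + Suc j"
      using after by (simp add: j_def)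
    then show thesis
      using outside[of L "take j R @ F (take a (drop j R)) # drop (j + a) R"]
      by (simp add: contract_def)
  next
    case mid
    define j where "j = i + a - length L - 1"
    have *: "i + a = length L + Suc j" "a - (length L - i) = Suc j"
      using mid by (auto simp: j_def)
    then show thesis
      using inside[of "take i L" "drop i L" "take j R" "drop j R"] mid
      by (simp add: contract_def)
  qed
qed

text \<open>The index \<open>i\<close> is the position of the first contraction, \<open>l\<close> that of the second one, which contracts
  \<open>b\<close> entries. Three cases: \<open>l \<le> i < l + b\<close>, the first result is contracted again; \<open>i < l\<close>; and
  \<open>l + b \<le> i\<close>. In the last sum the indices are renamed such that it runs over the same triangle as the
  second one.\<close>

lemma sum_two_insertions:
  fixes f :: "nat \<Rightarrow> nat \<Rightarrow> 'b::comm_monoid_add"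
  assumes "c \<ge> 1"
  shows "(\<Sum>i<b + c - 1. \<Sum>l<c. f i l) =
    (\<Sum>l<c. \<Sum>i<b. f (l + i) l) + (\<Sum>l<c. \<Sum>i<l. f i l) + (\<Sum>l<c. \<Sum>i<l. f (l + b - 1) i)"
proof -
  have "(\<Sum>i<b + c - 1. f i l) =
      (\<Sum>i<b. f (l + i) l) + (\<Sum>i<l. f i l) + (\<Sum>j | l < j \<and> j < c. f (j + b - 1) l)"
    if l: "l < c" for l
  proof -
    have "{..<b + c - 1} = {l..<l + b} \<union> ({..<l} \<union> {l + b..<b + c - 1})"
      using l by auto
    then have "(\<Sum>i<b + c - 1. f i l) =
        (\<Sum>i\<in>{l..<l + b}. f i l) + ((\<Sum>i<l. f i l) + (\<Sum>i\<in>{l + b..<b + c - 1}. f i l))"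
      by (simp only:) (subst sum.union_disjoint; force?)+
    moreover have "(\<Sum>i\<in>{l..<l + b}. f i l) = (\<Sum>i<b. f (l + i) l)"
      using sum.shift_bounds_nat_ivl[of "\<lambda>i. f i l" 0 l b]
      by (simp add: atLeast0LessThan add.commute)
    moreover have "(\<Sum>i\<in>{l + b..<b + c - 1}. f i l) = (\<Sum>j | l < j \<and> j < c. f (j + b - 1) l)"
      by (rule sum.reindex_bij_witness[where i="\<lambda>j. j + b - 1" and j="\<lambda>i. i + 1 - b"])
        (use l in auto)
    ultimately show ?thesis
      by (simp add: add.assoc)
  qed
  then have "(\<Sum>l<c. \<Sum>i<b + c - 1. f i l) = (\<Sum>l<c. \<Sum>i<b. f (l + i) l) +
      (\<Sum>l<c. \<Sum>i<l. f i l) + (\<Sum>l<c. \<Sum>j | l < j \<and> j < c. f (j + b - 1) l)"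
    by (simp add: sum.distrib)
  also have "(\<Sum>l<c. \<Sum>j | l < j \<and> j < c. f (j + b - 1) l) = (\<Sum>l<c. \<Sum>i<l. f (l + b - 1) i)"
  proof -
    have "(\<Sum>l<c. \<Sum>j | l < j \<and> j < c. f (j + b - 1) l) =
        (\<Sum>l<c. \<Sum>j | j \<in> {..<c} \<and> l < j. f (j + b - 1) l)"
      by (simp add: conj_commute)
    also have "\<dots> = (\<Sum>j<c. \<Sum>l | l \<in> {..<c} \<and> l < j. f (j + b - 1) l)"
      by (rule sum.swap_restrict) auto
    also have "\<dots> = (\<Sum>j<c. \<Sum>l<j. f (j + b - 1) l)"
      by (intro sum.cong) auto
    finally show ?thesis .
  qed
  finally show ?thesis
    by (subst sum.swap)
qed

section \<open>The operators \<open>j(K)\<close>\<close>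

context graded
begin

lemma homogeneous_contract:
  assumes "homogeneous_list U xs Xs" "K \<in> mlin U U a \<kappa>" "i + a \<le> length Xs"
  shows "homogeneous_list U (contract a (total_degree \<kappa>) i xs) (contract a K i Xs)"
proof -
  have len: "length xs = length Xs"
    using homogeneous_list_length[OF assms(1)] .
  have "K (take a (drop i Xs)) \<in> gpiece U (sum_list (take a (drop i xs)) + \<kappa>)"
    using assms len by (intro self.mlin_hom homogeneous_list_take homogeneous_list_drop) auto
  then show ?thesis
    unfolding contract_def using assms(1)
    by (intro homogeneous_list_append) (simp_all add: homogeneous_list_take homogeneous_list_drop)
qed

lemma M_hom_nat: "M_hom U (int a - 1, \<kappa>) = mlin U U a \<kappa>"
  by (simp add: M_hom_def)

lemma M_hom_cases:
  assumes "K \<in> M_hom U d"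
  obtains "K = 0" | a \<kappa> where "d = (int a - 1, \<kappa>)" "K \<in> mlin U U a \<kappa>"
proof (cases d)
  case (Pair k \<kappa>)
  then show thesis
    using assms that(1) that(2)[of "nat (k + 1)" \<kappa>]
    by (auto simp: M_hom_def split: if_splits)
qed

lemma M_hom_multilin: "K \<in> M_hom U (k, \<kappa>) \<Longrightarrow> self.multilin (nat (k + 1)) K"
  by (auto simp: M_hom_def self.mlin_multilin self.multilin_0 split: if_splits)

lemma fscale_zero: "fscale U r 0 = 0"
  by (simp add: fun_eq_iff fscale_def)

lemma M_hom_fscale: "K \<in> M_hom U d \<Longrightarrow> fscale U r K \<in> M_hom U d"
  by (cases d) (auto simp: M_hom_def self.mlin_fscale fscale_zero split: if_splits)

lemma j_formula_nat:
  "j_formula U (int a - 1, \<kappa>1) K1 (int b - 1, \<kappa>2) K2 xs Xs =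
    (if length Xs + 1 = a + b then
      (\<Sum>i<b. gscale U ((-1) powi ((int a - 1) * int i + deg_inner (grank U) \<kappa>1 (\<kappa>2 + sum_list (take i xs))))
        (K2 (contract a K1 i Xs)))
     else 0)"
  by (auto simp: j_formula_def contract_def)

lemma j_formula_zero_right: "j_formula U d1 K1 d2 0 xs Xs = 0"
  by (auto simp: j_formula_def split: prod.splits)

lemma j_formula_zero_left: "K2 \<in> M_hom U d2 \<Longrightarrow> j_formula U d1 0 d2 K2 xs Xs = 0"
  by (auto simp: j_formula_def multilinear_zero[OF M_hom_multilin] split: prod.splits)

text \<open>For fixed degrees \<open>xs\<close> the signs are constants, so the formula is multilinear in all arguments,
  homogeneous or not, and the extension lemmas for families of multilinear maps apply.\<close>

lemma multilin_j_formula: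
  assumes "K1 \<in> mlin U U a \<kappa>1" "K2 \<in> mlin U U b \<kappa>2"
  shows "self.multilin (a + b - 1) (j_formula U (int a - 1, \<kappa>1) K1 (int b - 1, \<kappa>2) K2 xs)"
proof (rule self.multilinI)
  note K1 = self.mlin_multilin[OF assms(1)] and K2 = self.mlin_multilin[OF assms(2)]
  fix L R :: "'a list" assume len: "length L + length R + 1 = a + b - 1"
  show "j_formula U (int a - 1, \<kappa>1) K1 (int b - 1, \<kappa>2) K2 xs (L @ (X + Y) # R) =
      j_formula U (int a - 1, \<kappa>1) K1 (int b - 1, \<kappa>2) K2 xs (L @ X # R) +
      j_formula U (int a - 1, \<kappa>1) K1 (int b - 1, \<kappa>2) K2 xs (L @ Y # R)" for X Y
  proof -
    have "K2 (contract a K1 i (L @ (X + Y) # R)) =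
        K2 (contract a K1 i (L @ X # R)) + K2 (contract a K1 i (L @ Y # R))" if "i < b" for i
    proof -
      have "i + a \<le> length L + length R + 1"
        using len that by simp
      then show ?thesis
        by (cases rule: contract_slot[of i a L R K1])
          (simp_all add: multilinear_add[OF K1] multilinear_add[OF K2])
    qed
    then show ?thesis
      using len by (simp add: j_formula_nat scale_right_distrib sum.distrib)
  qed
  show "j_formula U (int a - 1, \<kappa>1) K1 (int b - 1, \<kappa>2) K2 xs (L @ gscale U r X # R) =
      gscale U r (j_formula U (int a - 1, \<kappa>1) K1 (int b - 1, \<kappa>2) K2 xs (L @ X # R))" for X r
  proof -
    have "K2 (contract a K1 i (L @ gscale U r X # R)) =
        gscale U r (K2 (contract a K1 i (L @ X # R)))" if "i < b" for i
    proof -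
      have "i + a \<le> length L + length R + 1"
        using len that by simp
      then show ?thesis
        by (cases rule: contract_slot[of i a L R K1])
          (simp_all add: self.multilin_scale[OF K1] self.multilin_scale[OF K2])
    qed
    then show ?thesis
      using len by (simp add: j_formula_nat scale_sum_right mult.commute)
  qed
qed (auto simp: j_formula_nat)

lemma j_map_zero_left: "K2 \<in> M_hom U d2 \<Longrightarrow> j_map U d1 0 d2 K2 = 0"
  by (simp add: fun_eq_iff j_map_def j_formula_zero_left)

lemma j_map_zero_right: "j_map U d1 K1 d2 0 = 0"
  by (simp add: fun_eq_iff j_map_def j_formula_zero_right)

lemma j_formula_add_left:
  "K2 \<in> M_hom U d2 \<Longrightarrow> j_formula U d1 (K1 + K1') d2 K2 xs Xs =
    j_formula U d1 K1 d2 K2 xs Xs + j_formula U d1 K1' d2 K2 xs Xs"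
  by (cases d1; cases d2)
    (simp add: j_formula_def multilinear_add[OF M_hom_multilin] scale_right_distrib sum.distrib)

lemma j_formula_add_right:
  "j_formula U d1 K1 d2 (K2 + K2') xs Xs = j_formula U d1 K1 d2 K2 xs Xs + j_formula U d1 K1 d2 K2' xs Xs"
  by (cases d1; cases d2) (simp add: j_formula_def scale_right_distrib sum.distrib)

lemma j_formula_fscale_left:
  "K2 \<in> M_hom U d2 \<Longrightarrow> j_formula U d1 (fscale U r K1) d2 K2 xs Xs = gscale U r (j_formula U d1 K1 d2 K2 xs Xs)"
  by (cases d1; cases d2)
    (simp add: j_formula_def fscale_def self.multilin_scale[OF M_hom_multilin] scale_sum_right mult.commute)

lemma j_formula_fscale_right:
  "j_formula U d1 K1 d2 (fscale U r K2) xs Xs = gscale U r (j_formula U d1 K1 d2 K2 xs Xs)"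
  by (cases d1; cases d2) (simp add: j_formula_def fscale_def scale_sum_right mult.commute)

lemma j_map_add_left:
  "K2 \<in> M_hom U d2 \<Longrightarrow> j_map U d1 (K1 + K1') d2 K2 = j_map U d1 K1 d2 K2 + j_map U d1 K1' d2 K2"
  by (simp add: fun_eq_iff j_map_def j_formula_add_left sum.distrib)

lemma j_map_add_right: "j_map U d1 K1 d2 (K2 + K2') = j_map U d1 K1 d2 K2 + j_map U d1 K1 d2 K2'"
  by (simp add: fun_eq_iff j_map_def j_formula_add_right sum.distrib)

lemma j_map_fscale_left:
  "K2 \<in> M_hom U d2 \<Longrightarrow> j_map U d1 (fscale U r K1) d2 K2 = fscale U r (j_map U d1 K1 d2 K2)"
  by (simp add: fun_eq_iff j_map_def j_formula_fscale_left fscale_def[of _ _ "\<lambda>Xs. sum _ _"]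
      fscale_def[of _ _ "j_map _ _ _ _ _"] scale_sum_right)

lemma j_map_fscale_right: "j_map U d1 K1 d2 (fscale U r K2) = fscale U r (j_map U d1 K1 d2 K2)"
  by (simp add: fun_eq_iff j_map_def j_formula_fscale_right fscale_def[of _ _ "j_map _ _ _ _ _"]
      scale_sum_right)

lemma
  assumes "K1 \<in> mlin U U a \<kappa>1" "K2 \<in> mlin U U b \<kappa>2"
  shows j_map_nat_mem: "j_map U (int a - 1, \<kappa>1) K1 (int b - 1, \<kappa>2) K2 \<in> mlin U U (a + b - 1) (\<kappa>1 + \<kappa>2)"
    and j_map_nat_homogeneous: "homogeneous_list U xs Xs \<Longrightarrow>
      j_map U (int a - 1, \<kappa>1) K1 (int b - 1, \<kappa>2) K2 Xs =
      j_formula U (int a - 1, \<kappa>1) K1 (int b - 1, \<kappa>2) K2 xs Xs"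
proof -
  let ?\<phi> = "j_formula U (int a - 1, \<kappa>1) K1 (int b - 1, \<kappa>2) K2"
  let ?J = "j_map U (int a - 1, \<kappa>1) K1 (int b - 1, \<kappa>2) K2"
  have \<phi>: "self.multilin (a + b - 1) (?\<phi> xs)" for xs
    using multilin_j_formula[OF assms] .
  have \<phi>_length: "?\<phi> xs Xs = 0" if "length Xs \<noteq> a + b - 1" for xs Xs
    using that by (simp add: j_formula_nat)
  have J: "?J = self.extension ?\<phi>"
    by (rule ext) (simp add: j_map_def self.extension_def[OF \<phi> \<phi>_length])
  have mult: "self.multilin (a + b - 1) ?J"
    unfolding J using \<phi> \<phi>_length by (rule self.multilin_extension)
  show hom: "?J Xs = ?\<phi> xs Xs" if "homogeneous_list U xs Xs" for xs Xs
  proof (cases "length Xs = a + b - 1")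
    case True
    then show ?thesis
      unfolding J using \<phi> \<phi>_length that homogeneous_list_length[OF that]
      by (intro self.extension_homogeneous) auto
  next
    case False
    then show ?thesis
      using multilinear_length[OF mult] \<phi>_length by simp
  qed
  have "?J Xs \<in> gpiece U (sum_list xs + (\<kappa>1 + \<kappa>2))"
    if "length xs = a + b - 1" "homogeneous_list U xs Xs" for xs Xs
  proof -
    have len: "length Xs = length xs"
      using homogeneous_list_length[OF that(2)] by simp
    have "K2 (contract a K1 i Xs) \<in> gpiece U (sum_list xs + (\<kappa>1 + \<kappa>2))"
      if "i < b" "length Xs + 1 = a + b" for i
    proof -
      have i: "i + a \<le> length Xs" "i + a \<le> length xs"
        using that len by auto
      have "K2 (contract a K1 i Xs) \<in> gpiece U (sum_list (contract a (total_degree \<kappa>1) i xs) + \<kappa>2)"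
        using that len i(2) length_contract[OF i(2), of "total_degree \<kappa>1"]
        by (intro self.mlin_hom[OF assms(2)] homogeneous_contract[OF \<open>homogeneous_list U xs Xs\<close> assms(1) i(1)])
          auto
      then show ?thesis
        by (simp add: sum_list_contract[OF i(2)] add.assoc)
    qed
    then show ?thesis
      unfolding hom[OF that(2)] j_formula_nat
      by (auto intro!: sum_mem piece_scale zero_mem)
  qed
  then show "?J \<in> mlin U U (a + b - 1) (\<kappa>1 + \<kappa>2)"
    using mult by (simp add: mlin_def)
qed

text \<open>A nullary \<open>K\<^sub>2\<close> offers no place for an insertion. This case has to be kept apart because the
  truncated arity \<open>a + b - 1\<close> agrees with the degree of \<open>j(K\<^sub>1)K\<^sub>2\<close> only if \<open>b > 0\<close> or \<open>a > 0\<close>.\<close>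

lemma j_map_nullary: "j_map U d1 K1 (-1, \<kappa>2) K2 = 0"
proof -
  have "j_formula U d1 K1 (-1, \<kappa>2) K2 xs Xs = 0" for xs Xs
    by (auto simp: j_formula_def split: prod.splits)
  then show ?thesis
    by (simp add: fun_eq_iff j_map_def)
qed

lemma j_map_mem:
  assumes K1: "K1 \<in> M_hom U d1" and K2: "K2 \<in> M_hom U d2"
  shows "j_map U d1 K1 d2 K2 \<in> M_hom U (d1 + d2)"
  using K1
proof (cases rule: M_hom_cases)
  case 1
  then show ?thesis
    using K2 by (simp add: j_map_zero_left M.zero_mem)
next
  case (2 a \<kappa>1)
  note a = this
  show ?thesis
    using K2
  proof (cases rule: M_hom_cases)
    case 1
    then show ?thesis by (simp add: j_map_zero_right M.zero_mem)
  next
    case (2 b \<kappa>2)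
    show ?thesis
    proof (cases b)
      case 0
      then show ?thesis
        using 2 j_map_nullary by (simp add: M.zero_mem)
    next
      case (Suc b')
      then have "d1 + d2 = (int (a + b - 1) - 1, \<kappa>1 + \<kappa>2)"
        using a 2 by simp
      then show ?thesis
        using j_map_nat_mem[OF a(2) 2(2)] a(1) 2(1) M_hom_nat by metis
    qed
  qed
qed

end

definition koszul_sign :: "('k::field, 'a::ab_group_add) gspace \<Rightarrow> int \<times> deg \<Rightarrow> int \<times> deg \<Rightarrow> 'k" where
  "koszul_sign U d1 d2 = (-1) powi (fst d1 * fst d2 + deg_inner (grank U) (snd d1) (snd d2))"

lemma koszul_sign_commute: "koszul_sign U d1 d2 = koszul_sign U d2 d1"
  by (simp add: koszul_sign_def deg_inner_commute mult.commute)

lemma koszul_sign_add: "koszul_sign U d1 (d2 + d3) = koszul_sign U d1 d2 * koszul_sign U d1 d3"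
  by (simp add: koszul_sign_def deg_inner_add_right algebra_simps flip: sign_add)

lemma koszul_sign_cases: "koszul_sign U d1 d2 = 1 \<or> koszul_sign U d1 d2 = -1"
  by (simp add: koszul_sign_def sign_cases)

context graded
begin

text \<open>The summand of \<open>j(K\<^sub>1) (j(K\<^sub>2) K\<^sub>3)\<close> in which \<open>K\<^sub>1\<close> contracts a segment at position \<open>i\<close> first and
  \<open>K\<^sub>2\<close> then a segment of the result at position \<open>l\<close>.\<close>

definition double_insertion ::
  "nat \<Rightarrow> deg \<Rightarrow> ('a list \<Rightarrow> 'a) \<Rightarrow> nat \<Rightarrow> deg \<Rightarrow> ('a list \<Rightarrow> 'a) \<Rightarrow> deg \<Rightarrow> ('a list \<Rightarrow> 'a) \<Rightarrow>
   deg list \<Rightarrow> 'a list \<Rightarrow> nat \<Rightarrow> nat \<Rightarrow> 'a" where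
  "double_insertion a1 \<kappa>1 K1 a2 \<kappa>2 K2 \<kappa>3 K3 xs Xs i l =
    gscale U ((-1) powi ((int a1 - 1) * int i +
        deg_inner (grank U) \<kappa>1 (\<kappa>2 + \<kappa>3 + sum_list (take i xs)) + (int a2 - 1) * int l +
        deg_inner (grank U) \<kappa>2 (\<kappa>3 + sum_list (take l (contract a1 (total_degree \<kappa>1) i xs)))))
      (K3 (contract a2 K2 l (contract a1 K1 i Xs)))"

context
  fixes a1 a2 a3 :: nat and \<kappa>1 \<kappa>2 \<kappa>3 :: deg and K1 K2 K3 :: "'a list \<Rightarrow> 'a" and xs Xs
  assumes K1: "K1 \<in> mlin U U a1 \<kappa>1" and K2: "K2 \<in> mlin U U a2 \<kappa>2" and K3: "K3 \<in> mlin U U a3 \<kappa>3"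
    and Xs: "homogeneous_list U xs Xs" and len: "length Xs + 2 = a1 + a2 + a3" and a3: "a3 \<ge> 1"
begin

lemma j_map_j_map_eq_double_insertions:
  "j_map U (int a1 - 1, \<kappa>1) K1 ((int a2 - 1, \<kappa>2) + (int a3 - 1, \<kappa>3))
      (j_map U (int a2 - 1, \<kappa>2) K2 (int a3 - 1, \<kappa>3) K3) Xs =
    (\<Sum>i<a2 + a3 - 1. \<Sum>l<a3. double_insertion a1 \<kappa>1 K1 a2 \<kappa>2 K2 \<kappa>3 K3 xs Xs i l)"
proof -
  let ?J = "j_map U (int a2 - 1, \<kappa>2) K2 (int a3 - 1, \<kappa>3) K3"
  have d: "(int a2 - 1, \<kappa>2) + (int a3 - 1, \<kappa>3) = (int (a2 + a3 - 1) - 1, \<kappa>2 + \<kappa>3)"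
    using a3 by simp
  have len': "length Xs + 1 = a1 + (a2 + a3 - 1)"
    using len a3 by simp
  have J: "?J (contract a1 K1 i Xs) =
      (\<Sum>l<a3. gscale U ((-1) powi ((int a2 - 1) * int l +
          deg_inner (grank U) \<kappa>2 (\<kappa>3 + sum_list (take l (contract a1 (total_degree \<kappa>1) i xs)))))
        (K3 (contract a2 K2 l (contract a1 K1 i Xs))))"
    if "i < a2 + a3 - 1" for i
  proof -
    have i: "i + a1 \<le> length Xs"
      using that len' by simp
    then have "length (contract a1 K1 i Xs) + 1 = a2 + a3"
      using length_contract[OF i, of K1] len by simp
    then show ?thesis
      using j_map_nat_homogeneous[OF K2 K3 homogeneous_contract[OF Xs K1 i]]
      by (simp only: j_formula_nat if_True simp_thms)
  qed
  show ?thesis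
    unfolding d j_map_nat_homogeneous[OF K1 j_map_nat_mem[OF K2 K3] Xs] j_formula_nat if_P[OF len']
    by (intro sum.cong refl)
      (simp add: J double_insertion_def scale_sum_right add.assoc flip: sign_add)
qed

text \<open>The segment of \<open>K\<^sub>1\<close> lies inside the segment of \<open>K\<^sub>2\<close>, and the arguments in front of the outer segment
  are passed by \<open>K\<^sub>1\<close> as well as by \<open>K\<^sub>2\<close>: the sign is the one that \<open>j(K\<^sub>1)K\<^sub>2\<close> acquires in front of
  position \<open>l\<close> times the one of \<open>K\<^sub>1\<close> inside \<open>K\<^sub>2\<close>.\<close>

lemma double_insertion_nested:
  assumes l: "l < a3" and i: "i < a2"
  shows "double_insertion a1 \<kappa>1 K1 a2 \<kappa>2 K2 \<kappa>3 K3 xs Xs (l + i) l =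
    gscale U ((-1) powi ((int (a1 + a2 - 1) - 1) * int l +
        deg_inner (grank U) (\<kappa>1 + \<kappa>2) (\<kappa>3 + sum_list (take l xs))))
      (gscale U ((-1) powi ((int a1 - 1) * int i +
          deg_inner (grank U) \<kappa>1 (\<kappa>2 + sum_list (take i (take (a1 + a2 - 1) (drop l xs))))))
        (K3 (contract (a1 + a2 - 1) (\<lambda>Z. K2 (contract a1 K1 i Z)) l Xs)))"
proof -
  have len': "length xs = length Xs"
    using homogeneous_list_length[OF Xs] .
  have "contract a2 K2 l (contract a1 K1 (l + i) Xs) = contract (a1 + a2 - 1) (\<lambda>Z. K2 (contract a1 K1 i Z)) l Xs"
    using l i len by (intro contract_contract_nested) auto
  moreover have "take l (contract a1 (total_degree \<kappa>1) (l + i) xs) = take l xs"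
    using l i len len' by (intro take_contract) auto
  moreover have "sum_list (take (l + i) xs) = sum_list (take l xs) + sum_list (take i (take (a1 + a2 - 1) (drop l xs)))"
    using i by (simp add: take_add min_def)
  moreover have "int (a1 + a2 - 1) = int a1 + int a2 - 1"
    using i by simp
  ultimately show ?thesis
    unfolding double_insertion_def
    by (simp add: deg_inner_add_left deg_inner_add_right algebra_simps flip: sign_add)
qed

text \<open>The two results are the same list, so only the signs have to be compared. When \<open>K\<^sub>2\<close> goes first,
  \<open>K\<^sub>1\<close> has to pass its value, of weight increased by \<open>\<kappa>\<^sub>2\<close>, and \<open>a\<^sub>2 - 1\<close> entries fewer; this is the
  Koszul sign.\<close>

lemma double_insertion_disjoint:
  assumes l: "l + 1 + m < a3"
  shows "double_insertion a1 \<kappa>1 K1 a2 \<kappa>2 K2 \<kappa>3 K3 xs Xs (l + a2 + m) l =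
    gscale U (koszul_sign U (int a1 - 1, \<kappa>1) (int a2 - 1, \<kappa>2))
      (double_insertion a2 \<kappa>2 K2 a1 \<kappa>1 K1 \<kappa>3 K3 xs Xs l (l + 1 + m))"
proof -
  have len': "length xs = length Xs"
    using homogeneous_list_length[OF Xs] .
  have "contract a2 K2 l (contract a1 K1 (l + a2 + m) Xs) = contract a1 K1 (l + 1 + m) (contract a2 K2 l Xs)"
    using l len by (intro contract_contract_disjoint) auto
  moreover have "take l (contract a1 (total_degree \<kappa>1) (l + a2 + m) xs) = take l xs"
    using l len len' by (intro take_contract) auto
  moreover have "sum_list (take (l + 1 + m) (contract a2 (total_degree \<kappa>2) l xs)) =
      sum_list (take (l + a2 + m) xs) + \<kappa>2"
    using l len len' by (intro sum_list_take_contract) auto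
  ultimately show ?thesis
    unfolding double_insertion_def koszul_sign_def fst_conv snd_conv scale_scale sign_add[symmetric]
    by (simp only:) (rule arg_cong2[where f="gscale U", OF sign_eqI refl],
        simp add: deg_inner_commute[of _ \<kappa>2 \<kappa>1] deg_inner_add_right algebra_simps)
qed

lemma j_map_comp_eq_double_insertions:
  "j_map U ((int a1 - 1, \<kappa>1) + (int a2 - 1, \<kappa>2))
      (j_map U (int a1 - 1, \<kappa>1) K1 (int a2 - 1, \<kappa>2) K2) (int a3 - 1, \<kappa>3) K3 Xs =
    (\<Sum>l<a3. \<Sum>i<a2. double_insertion a1 \<kappa>1 K1 a2 \<kappa>2 K2 \<kappa>3 K3 xs Xs (l + i) l)"
proof (cases "a2 = 0")
  case True
  have "K3 \<in> M_hom U (int a3 - 1, \<kappa>3)"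
    using K3 by (simp add: M_hom_nat)
  then show ?thesis
    using True by (simp add: j_map_nullary j_map_zero_left)
next
  case False
  let ?J = "j_map U (int a1 - 1, \<kappa>1) K1 (int a2 - 1, \<kappa>2) K2"
  let ?a = "a1 + a2 - 1"
  let ?s = "\<lambda>l. (-1) powi ((int ?a - 1) * int l + deg_inner (grank U) (\<kappa>1 + \<kappa>2) (\<kappa>3 + sum_list (take l xs)))"
  let ?t = "\<lambda>l i. (-1) powi ((int a1 - 1) * int i +
      deg_inner (grank U) \<kappa>1 (\<kappa>2 + sum_list (take i (take ?a (drop l xs)))))"
  have d: "(int a1 - 1, \<kappa>1) + (int a2 - 1, \<kappa>2) = (int ?a - 1, \<kappa>1 + \<kappa>2)"
    using False by simp
  have len': "length Xs + 1 = ?a + a3"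
    using len False by simp
  have J: "K3 (contract ?a ?J l Xs) =
      (\<Sum>i<a2. gscale U (?t l i) (K3 (contract ?a (\<lambda>Z. K2 (contract a1 K1 i Z)) l Xs)))"
    if l: "l < a3" for l
  proof -
    have seg: "homogeneous_list U (take ?a (drop l xs)) (take ?a (drop l Xs))"
      using Xs by (intro homogeneous_list_take homogeneous_list_drop)
    have "length (take ?a (drop l Xs)) + 1 = a1 + a2"
      using l len' False by simp
    then have "?J (take ?a (drop l Xs)) =
        (\<Sum>i<a2. gscale U (?t l i) (K2 (contract a1 K1 i (take ?a (drop l Xs)))))"
      using j_map_nat_homogeneous[OF K1 K2 seg] by (simp only: j_formula_nat if_True simp_thms)
    then show ?thesis
      unfolding contract_def[of ?a]
      by (simp only: multilinear_sum[OF self.mlin_multilin[OF K3]]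
          self.multilin_scale[OF self.mlin_multilin[OF K3]])
  qed
  show ?thesis
    unfolding d j_map_nat_homogeneous[OF j_map_nat_mem[OF K1 K2] K3 Xs] j_formula_nat if_P[OF len']
    by (intro sum.cong refl, simp only: J scale_sum_right lessThan_iff)
      (intro sum.cong refl, simp only: double_insertion_nested lessThan_iff)
qed

end

text \<open>Contracting two disjoint segments in either order gives the same list, so in the graded
  commutator of \<open>j(K\<^sub>1)\<close> and \<open>j(K\<^sub>2)\<close> only the summands survive in which one segment lies inside the
  other: the commutator is \<open>j([K\<^sub>1, K\<^sub>2])\<close>.\<close>

lemma j_map_commutator_nat:
  assumes K1: "K1 \<in> mlin U U a1 \<kappa>1" and K2: "K2 \<in> mlin U U a2 \<kappa>2" and K3: "K3 \<in> mlin U U a3 \<kappa>3"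
    and d: "d1 = (int a1 - 1, \<kappa>1)" "d2 = (int a2 - 1, \<kappa>2)" "d3 = (int a3 - 1, \<kappa>3)"
    and Xs: "homogeneous_list U xs Xs" and len: "length Xs + 2 = a1 + a2 + a3" and a3: "a3 \<ge> 1"
  shows "j_map U d1 K1 (d2 + d3) (j_map U d2 K2 d3 K3) Xs -
      gscale U (koszul_sign U d1 d2) (j_map U d2 K2 (d1 + d3) (j_map U d1 K1 d3 K3) Xs) =
    j_map U (d1 + d2) (j_map U d1 K1 d2 K2) d3 K3 Xs -
      gscale U (koszul_sign U d1 d2) (j_map U (d2 + d1) (j_map U d2 K2 d1 K1) d3 K3 Xs)"
proof -
  let ?s = "koszul_sign U d1 d2"
  let ?f = "double_insertion a1 \<kappa>1 K1 a2 \<kappa>2 K2 \<kappa>3 K3 xs Xs"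
  let ?g = "double_insertion a2 \<kappa>2 K2 a1 \<kappa>1 K1 \<kappa>3 K3 xs Xs"
  have len': "length Xs + 2 = a2 + a1 + a3"
    using len by simp
  have f: "(\<Sum>l<a3. \<Sum>i<l. ?f (l + a2 - 1) i) = gscale U ?s (\<Sum>l<a3. \<Sum>i<l. ?g i l)"
  proof -
    have "?f (l + a2 - 1) i = gscale U ?s (?g i l)" if "l < a3" "i < l" for l i
    proof -
      define m where "m = l - i - 1"
      have "i + 1 + m = l" "i + a2 + m = l + a2 - 1"
        using that by (auto simp: m_def)
      then show ?thesis
        using double_insertion_disjoint[OF K1 K2 K3 Xs len a3, of i m] that by (simp add: d)
    qed
    then show ?thesis
      by (simp add: scale_sum_right)
  qed
  have g: "(\<Sum>l<a3. \<Sum>i<l. ?g (l + a1 - 1) i) = gscale U ?s (\<Sum>l<a3. \<Sum>i<l. ?f i l)"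
  proof -
    have "?g (l + a1 - 1) i = gscale U ?s (?f i l)" if "l < a3" "i < l" for l i
    proof -
      define m where "m = l - i - 1"
      have "i + 1 + m = l" "i + a1 + m = l + a1 - 1"
        using that by (auto simp: m_def)
      then show ?thesis
        using double_insertion_disjoint[OF K2 K1 K3 Xs len' a3, of i m] that
        by (simp add: d koszul_sign_commute[of U "(int a2 - 1, \<kappa>2)"])
    qed
    then show ?thesis
      by (simp add: scale_sum_right)
  qed
  show ?thesis
    unfolding d
      j_map_j_map_eq_double_insertions[OF K1 K2 K3 Xs len a3]
      j_map_j_map_eq_double_insertions[OF K2 K1 K3 Xs len' a3]
      j_map_comp_eq_double_insertions[OF K1 K2 K3 Xs len a3]
      j_map_comp_eq_double_insertions[OF K2 K1 K3 Xs len' a3]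
      sum_two_insertions[OF a3] f[unfolded d] g[unfolded d]
    using koszul_sign_cases[of U "(int a1 - 1, \<kappa>1)" "(int a2 - 1, \<kappa>2)"]
    by (auto simp: algebra_simps)
qed

text \<open>Both sides are multilinear of the same degree, so it suffices to compare them on homogeneous
  arguments. Both vanish if some \<open>K\<^sub>i\<close> is zero, if \<open>K\<^sub>3\<close> is nullary, or if \<open>K\<^sub>1\<close> and \<open>K\<^sub>2\<close> are nullary and
  \<open>K\<^sub>3\<close> is unary, because then the total degree is \<open>-2\<close>.\<close>

lemma j_map_commutator:
  assumes "K1 \<in> M_hom U d1" "K2 \<in> M_hom U d2" "K3 \<in> M_hom U d3"
  shows "j_map U d1 K1 (d2 + d3) (j_map U d2 K2 d3 K3) -
      fscale U (koszul_sign U d1 d2) (j_map U d2 K2 (d1 + d3) (j_map U d1 K1 d3 K3)) =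
    j_map U (d1 + d2) (j_map U d1 K1 d2 K2) d3 K3 -
      fscale U (koszul_sign U d1 d2) (j_map U (d2 + d1) (j_map U d2 K2 d1 K1) d3 K3)"
    (is "?L = ?R")
proof (cases "K1 = 0 \<or> K2 = 0 \<or> K3 = 0 \<or> fst d3 = -1")
  case True
  then show ?thesis
  proof (elim disjE)
    assume "fst d3 = -1"
    then show ?thesis
      by (cases d3) (simp add: j_map_nullary j_map_zero_right fscale_zero)
  qed (use assms in \<open>simp_all add: j_map_zero_left j_map_zero_right fscale_zero j_map_mem\<close>)
next
  case False
  obtain a1 \<kappa>1 where 1: "d1 = (int a1 - 1, \<kappa>1)" "K1 \<in> mlin U U a1 \<kappa>1"
    using M_hom_cases[OF assms(1)] False by blast
  obtain a2 \<kappa>2 where 2: "d2 = (int a2 - 1, \<kappa>2)" "K2 \<in> mlin U U a2 \<kappa>2"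
    using M_hom_cases[OF assms(2)] False by blast
  obtain a3 \<kappa>3 where 3: "d3 = (int a3 - 1, \<kappa>3)" "K3 \<in> mlin U U a3 \<kappa>3"
    using M_hom_cases[OF assms(3)] False by blast
  have a3: "a3 \<ge> 1"
    using False 3 by (cases a3) auto
  have "?L \<in> M_hom U (d1 + d2 + d3)" "?R \<in> M_hom U (d1 + d2 + d3)"
  proof -
    have "d2 + (d1 + d3) = d1 + d2 + d3" "d1 + (d2 + d3) = d1 + d2 + d3" "d2 + d1 + d3 = d1 + d2 + d3"
      by (simp_all add: ac_simps)
    then show "?L \<in> M_hom U (d1 + d2 + d3)" "?R \<in> M_hom U (d1 + d2 + d3)"
      using assms j_map_mem M.diff_mem M_hom_fscale by metis+
  qed
  then have "self.multilin (nat (fst (d1 + d2 + d3) + 1)) ?L" "self.multilin (nat (fst (d1 + d2 + d3) + 1)) ?R"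
    using M_hom_multilin by (metis prod.collapse)+
  then show ?thesis
  proof (cases "a1 + a2 + a3 \<ge> 2")
    case True
    show ?thesis
      using \<open>self.multilin _ ?L\<close> \<open>self.multilin _ ?R\<close>
    proof (rule self.multilin_eqI)
      fix xs Xs assume Xs: "length xs = nat (fst (d1 + d2 + d3) + 1)" "homogeneous_list U xs Xs"
      then have "length Xs + 2 = a1 + a2 + a3"
        using homogeneous_list_length[OF Xs(2)] 1 2 3 True by simp
      then show "?L Xs = ?R Xs"
        using j_map_commutator_nat[OF 1(2) 2(2) 3(2) 1(1) 2(1) 3(1) Xs(2) _ a3] by (simp add: fscale_def)
    qed
  next
    case False
    then have "d1 + d2 + d3 = (int (a1 + a2 + a3) - 3, \<kappa>1 + \<kappa>2 + \<kappa>3)" "int (a1 + a2 + a3) - 3 < -1"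
      using 1 2 3 by simp_all
    then have "M_hom U (d1 + d2 + d3) = {0}"
      by (simp add: M_hom_def)
    then show ?thesis
      using \<open>?L \<in> _\<close> \<open>?R \<in> _\<close> by auto
  qed
qed

section \<open>The graded Lie algebra \<open>M(U)\<close>\<close>

lemma bracket_hom_eq:
  "bracket_hom U d1 K1 d2 K2 = j_map U d1 K1 d2 K2 - fscale U (koszul_sign U d1 d2) (j_map U d2 K2 d1 K1)"
  by (cases d1; cases d2) (simp add: bracket_hom_def koszul_sign_def)

lemma fscale_add: "fscale U r (f + g) = fscale U r f + fscale U r g"
  by (simp add: fun_eq_iff fscale_def scale_right_distrib)

lemma fscale_diff: "fscale U r (f - g) = fscale U r f - fscale U r g"
  by (simp add: fun_eq_iff fscale_def scale_right_diff_distrib)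

lemma fscale_one: "fscale U 1 f = f"
  by (simp add: fun_eq_iff fscale_def)

lemma fscale_minus_left: "fscale U (- r) f = - fscale U r f"
  by (simp add: fun_eq_iff fscale_def)

lemma fscale_fscale: "fscale U r (fscale U s f) = fscale U (r * s) f"
  by (simp add: fun_eq_iff fscale_def)

lemma bracket_hom_mem:
  assumes "K1 \<in> M_hom U d1" "K2 \<in> M_hom U d2"
  shows "bracket_hom U d1 K1 d2 K2 \<in> M_hom U (d1 + d2)"
  using j_map_mem[OF assms] j_map_mem[OF assms(2,1)]
  by (simp add: bracket_hom_eq M.diff_mem M_hom_fscale add.commute)

lemma bracket_hom_add_left:
  "K2 \<in> M_hom U d2 \<Longrightarrow> bracket_hom U d1 (K1 + K1') d2 K2 = bracket_hom U d1 K1 d2 K2 + bracket_hom U d1 K1' d2 K2"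
  by (simp add: bracket_hom_eq j_map_add_left j_map_add_right fscale_add)

lemma bracket_hom_add_right:
  "K1 \<in> M_hom U d1 \<Longrightarrow> bracket_hom U d1 K1 d2 (K2 + K2') = bracket_hom U d1 K1 d2 K2 + bracket_hom U d1 K1 d2 K2'"
  by (simp add: bracket_hom_eq j_map_add_left j_map_add_right fscale_add)

lemma bracket_hom_fscale_left:
  "K2 \<in> M_hom U d2 \<Longrightarrow> bracket_hom U d1 (fscale U r K1) d2 K2 = fscale U r (bracket_hom U d1 K1 d2 K2)"
  by (simp add: bracket_hom_eq j_map_fscale_left j_map_fscale_right fscale_diff fscale_fscale mult.commute)

lemma bracket_hom_fscale_right:
  "K1 \<in> M_hom U d1 \<Longrightarrow> bracket_hom U d1 K1 d2 (fscale U r K2) = fscale U r (bracket_hom U d1 K1 d2 K2)"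
  by (simp add: bracket_hom_eq j_map_fscale_left j_map_fscale_right fscale_diff fscale_fscale mult.commute)

lemma bracket_hom_zero_left: "K2 \<in> M_hom U d2 \<Longrightarrow> bracket_hom U d1 0 d2 K2 = 0"
  by (simp add: bracket_hom_eq j_map_zero_left j_map_zero_right fscale_zero)

lemma bracket_hom_zero_right: "K1 \<in> M_hom U d1 \<Longrightarrow> bracket_hom U d1 K1 d2 0 = 0"
  by (simp add: bracket_hom_eq j_map_zero_left j_map_zero_right fscale_zero)

text \<open>After expansion each term is a composite of two operators \<open>j\<close> or \<open>j\<close> of a value of \<open>j\<close>. Replacing
  \<open>j(K\<^sub>a) j(K\<^sub>b) K\<^sub>c\<close> by the commutator rule for the pairs \<open>(1,2)\<close>, \<open>(1,3)\<close>, \<open>(2,3)\<close> makes everything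
  cancel; the three Koszul signs are independent, which gives eight linear identities.\<close>

lemma bracket_hom_jacobi:
  assumes K: "K1 \<in> M_hom U d1" "K2 \<in> M_hom U d2" "K3 \<in> M_hom U d3"
  shows "bracket_hom U d1 K1 (d2 + d3) (bracket_hom U d2 K2 d3 K3) =
    bracket_hom U (d1 + d2) (bracket_hom U d1 K1 d2 K2) d3 K3 +
    fscale U (koszul_sign U d1 d2) (bracket_hom U d2 K2 (d1 + d3) (bracket_hom U d1 K1 d3 K3))"
proof -
  have minus: "j_map U e (K - K') e' L = j_map U e K e' L - j_map U e K' e' L"
    if "L \<in> M_hom U e'" for e e' K K' L
    using j_map_add_left[OF that, of e "K - K'" K'] by simp
  have minus': "j_map U e L e' (K - K') = j_map U e L e' K - j_map U e L e' K'" for e e' K K' L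
    using j_map_add_right[of e L e' "K - K'" K'] by simp
  note expand = minus[OF K(1)] minus[OF K(2)] minus[OF K(3)] minus'
    j_map_fscale_left[OF K(1)] j_map_fscale_left[OF K(2)] j_map_fscale_left[OF K(3)] j_map_fscale_right
  note c = j_map_commutator[OF K(1,2,3), unfolded diff_eq_eq]
    j_map_commutator[OF K(1,3,2), unfolded diff_eq_eq] j_map_commutator[OF K(2,3,1), unfolded diff_eq_eq]
  have comm: "koszul_sign U d2 d1 = koszul_sign U d1 d2" "koszul_sign U d3 d1 = koszul_sign U d1 d3"
    "koszul_sign U d3 d2 = koszul_sign U d2 d3" "d2 + d1 = d1 + d2" "d3 + d1 = d1 + d3" "d3 + d2 = d2 + d3"
    by (simp_all add: koszul_sign_commute add.commute)
  have sgn: "koszul_sign U d1 (d2 + d3) = koszul_sign U d1 d2 * koszul_sign U d1 d3"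
    "koszul_sign U d2 (d1 + d3) = koszul_sign U d1 d2 * koszul_sign U d2 d3"
    "koszul_sign U (d1 + d2) d3 = koszul_sign U d1 d3 * koszul_sign U d2 d3"
    using koszul_sign_add[of U d1 d2 d3] koszul_sign_add[of U d2 d1 d3] koszul_sign_add[of U d3 d1 d2]
    by (simp_all add: koszul_sign_commute[of U "d1 + d2"] comm)
  show ?thesis
    unfolding bracket_hom_eq expand sgn comm c[unfolded comm]
    using koszul_sign_cases[of U d1 d2] koszul_sign_cases[of U d1 d3] koszul_sign_cases[of U d2 d3]
    by (elim disjE) (simp_all add: fscale_one fscale_minus_left fscale_add fscale_diff algebra_simps)
qed

end

context graded
begin

\<comment> \<open>Resolution leaves sums of maps in eta-expanded form, which the pointwise rules would break up.\<close>
context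
  notes plus_fun_apply [simp del] zero_fun_apply [simp del]
begin

lemma fscale_sum: "fscale U r (sum f S) = (\<Sum>i\<in>S. fscale U r (f i))"
  by (induction S rule: infinite_finite_induct) (auto simp: fscale_zero fscale_add)

lemma M_space_eq: "M_space U = dsum (M_hom U)"
  by (simp add: M_space_def)

lemma bracket_homogeneous:
  assumes "K1 \<in> M_hom U d1" "K2 \<in> M_hom U d2"
  shows "bracket U K1 K2 = bracket_hom U d1 K1 d2 K2"
proof -
  have K2: "component (M_hom U) K2 d \<in> M_hom U d" for d
    by (rule M.component_mem[OF M.hom_mem_dsum[OF assms(2)]])
  have "bracket U K1 K2 = (\<Sum>e | component (M_hom U) K2 e \<noteq> 0. bracket_hom U d1 K1 e (component (M_hom U) K2 e))"
    unfolding bracket_def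
    using K2 by (intro M.extension_hom[OF assms(1)]) (simp add: bracket_hom_zero_left)
  also have "\<dots> = bracket_hom U d1 K1 d2 K2"
    using assms by (intro M.extension_hom[OF assms(2)]) (simp add: bracket_hom_zero_right)
  finally show ?thesis .
qed

lemma bracket_mem: "K1 \<in> M_hom U d1 \<Longrightarrow> K2 \<in> M_hom U d2 \<Longrightarrow> bracket U K1 K2 \<in> M_hom U (d1 + d2)"
  by (simp add: bracket_homogeneous bracket_hom_mem)

lemma bracket_add_left:
  assumes "K1 \<in> M_space U" "K1' \<in> M_space U" "K2 \<in> M_space U"
  shows "bracket U (K1 + K1') K2 = bracket U K1 K2 + bracket U K1' K2"
  using assms unfolding bracket_def M_space_eq
  by (intro M.extension_add) (simp_all add: bracket_hom_add_left M.component_mem sum.distrib)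

lemma bracket_add_right:
  assumes "K1 \<in> M_space U" "K2 \<in> M_space U" "K2' \<in> M_space U"
  shows "bracket U K1 (K2 + K2') = bracket U K1 K2 + bracket U K1 K2'"
proof -
  have "(\<Sum>e | component (M_hom U) (K2 + K2') e \<noteq> 0. bracket_hom U d (component (M_hom U) K1 d) e (component (M_hom U) (K2 + K2') e)) =
      (\<Sum>e | component (M_hom U) K2 e \<noteq> 0. bracket_hom U d (component (M_hom U) K1 d) e (component (M_hom U) K2 e)) +
      (\<Sum>e | component (M_hom U) K2' e \<noteq> 0. bracket_hom U d (component (M_hom U) K1 d) e (component (M_hom U) K2' e))" for d
    using assms unfolding M_space_eq
    by (intro M.extension_add) (simp_all add: bracket_hom_add_right M.component_mem)
  then show ?thesis
    unfolding bracket_def by (simp add: sum.distrib)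
qed

lemma bracket_fscale_left:
  assumes "K1 \<in> M_space U" "K2 \<in> M_space U"
  shows "bracket U (fscale U r K1) K2 = fscale U r (bracket U K1 K2)"
proof -
  have "component (M_hom U) K2 e \<in> M_hom U e" for e
    using assms by (simp add: M_space_eq M.component_mem)
  then show ?thesis
    using assms unfolding bracket_def M_space_eq
    by (intro M.extension_map[where \<phi>="fscale U r" and \<psi>="fscale U r"])
      (simp_all add: bracket_hom_zero_left bracket_hom_fscale_left fscale_zero
        fscale_add fscale_sum M_hom_fscale)
qed

lemma bracket_fscale_right:
  assumes "K1 \<in> M_space U" "K2 \<in> M_space U"
  shows "bracket U K1 (fscale U r K2) = fscale U r (bracket U K1 K2)"
proof -
  have "(\<Sum>e | component (M_hom U) (fscale U r K2) e \<noteq> 0. bracket_hom U d (component (M_hom U) K1 d) e (component (M_hom U) (fscale U r K2) e)) =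
      fscale U r (\<Sum>e | component (M_hom U) K2 e \<noteq> 0. bracket_hom U d (component (M_hom U) K1 d) e (component (M_hom U) K2 e))" for d
    using assms unfolding M_space_eq
    by (intro M.extension_map[where \<phi>="fscale U r" and \<psi>="fscale U r"])
      (simp_all add: bracket_hom_zero_right bracket_hom_fscale_right M.component_mem fscale_zero
        fscale_add M_hom_fscale)
  then show ?thesis
    unfolding bracket_def by (simp add: fscale_sum)
qed

lemma bracket_zero_left: "bracket U 0 K = 0"
  by (simp add: bracket_def M.component_zero zero_fun_apply)

lemma bracket_zero_right: "bracket U K 0 = 0"
  by (simp add: bracket_def M.component_zero zero_fun_apply)

lemma bracket_mem_M_space:
  assumes K1: "K1 \<in> M_space U" and K2: "K2 \<in> M_space U"
  shows "bracket U K1 K2 \<in> M_space U"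
  using K1 unfolding M_space_eq
proof (induction rule: M.dsum_induct)
  case zero
  then show ?case by (simp add: bracket_zero_left M.zero_mem_dsum)
next
  case (add d Y Z)
  have "bracket U Y K2 \<in> dsum (M_hom U)"
    using K2 unfolding M_space_eq
  proof (induction rule: M.dsum_induct)
    case zero
    then show ?case by (simp add: bracket_zero_right M.zero_mem_dsum)
  next
    case (add e Y' Z')
    then show ?case
      using bracket_add_right[of Y Y' Z'] M.hom_mem_dsum[OF bracket_mem[OF \<open>Y \<in> M_hom U d\<close> add(1)]]
        \<open>Y \<in> M_hom U d\<close>
      by (simp add: M_space_eq M.hom_mem_dsum M.add_mem_dsum)
  qed
  then show ?case
    using add K2 bracket_add_left[of Y Z K2] by (simp add: M_space_eq M.hom_mem_dsum M.add_mem_dsum)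
qed

lemma bracket_jacobi:
  assumes "K1 \<in> M_hom U d1" "K2 \<in> M_hom U d2" "K3 \<in> M_hom U d3"
  shows "bracket U K1 (bracket U K2 K3) =
    bracket U (bracket U K1 K2) K3 + fscale U (koszul_sign U d1 d2) (bracket U K2 (bracket U K1 K3))"
  using bracket_hom_jacobi[OF assms] assms
  by (simp add: bracket_homogeneous[of _ "d1 + d2" _ d3] bracket_homogeneous[of _ d1 _ "d2 + d3"]
      bracket_homogeneous[of _ d2 _ "d1 + d3"] bracket_homogeneous[of _ d1 _ d2]
      bracket_homogeneous[of _ d1 _ d3] bracket_homogeneous[of _ d2 _ d3] bracket_hom_mem)

text \<open>Since \<open>P\<close> is odd, the Jacobi identity for \<open>P, P, K\<close> reads
  \<open>[P, [P, K]] = [[P, P], K] - [P, [P, K]]\<close>, and the first term on the right vanishes.\<close>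

lemma bracket_square_zero:
  assumes two: "(2::'k) \<noteq> 0" and P: "P \<in> M_hom U (1, 0)" "bracket U P P = 0" and K: "K \<in> M_space U"
  shows "bracket U P (bracket U P K) = 0"
  using K unfolding M_space_eq
proof (induction rule: M.dsum_induct)
  case zero
  then show ?case by (simp add: bracket_zero_right)
next
  case (add d Y Z)
  have "koszul_sign U (1, 0) (1, 0) = (-1 :: 'k)"
    by (simp add: koszul_sign_def)
  then have "bracket U P (bracket U P Y) = - bracket U P (bracket U P Y)"
    using bracket_jacobi[OF P(1,1) add(1)] P(2)
    by (simp add: bracket_zero_left fscale_minus_left fscale_one)
  then have "bracket U P (bracket U P Y) Xs + bracket U P (bracket U P Y) Xs = 0" for Xs
    by (metis ab_left_minus plus_fun_apply zero_fun_apply)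
  then have "gscale U 2 (bracket U P (bracket U P Y) Xs) = 0" for Xs
    by (metis one_add_one scale_left_distrib scale_one)
  then have "bracket U P (bracket U P Y) = 0"
    using two by (simp add: fun_eq_iff zero_fun_apply)
  then show ?case
    using add P(1) bracket_mem_M_space[of P]
    by (simp add: bracket_add_right M_space_eq M.hom_mem_dsum)
qed

end

end

section \<open>The graded space \<open>E = V \<oplus> W\<close>\<close>

locale graded_sum = V: graded V + W: graded W
  for V :: "('k::field, 'v::ab_group_add) gspace" and W :: "('k, 'w::ab_group_add) gspace" +
  assumes same_rank: "grank V = grank W"
begin

abbreviation "E \<equiv> E_space V W"

abbreviation shift_deg :: "deg \<Rightarrow> deg" where
  "shift_deg z \<equiv> (\<lambda>i. z (Suc i))"

interpretation VW: vector_space_prod "gscale V" "gscale W"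
  by unfold_locales

lemma grank_E: "grank E = Suc (grank V)"
  by (simp add: E_space_def)

lemma gscale_E: "gscale E r Z = (gscale V r (fst Z), gscale W r (snd Z))"
  by (simp add: E_space_def VW.scale_def)

lemma piece_E: "gpiece E z = (if z 0 = 0 then gpiece V (shift_deg z) \<times> {0}
    else if z 0 = 1 then {0} \<times> gpiece W (shift_deg z) else {0})"
  by (simp add: E_space_def)

lemma piece_E_case_nat:
  "gpiece E (case_nat 0 x) = gpiece V x \<times> {0}" "gpiece E (case_nat 1 x) = {0} \<times> gpiece W x"
  by (simp_all add: piece_E)

lemma piece_E_cases:
  assumes "Z \<in> gpiece E z"
  obtains "z 0 = 0" "fst Z \<in> gpiece V (shift_deg z)" "snd Z = 0"
  | "z 0 = 1" "fst Z = 0" "snd Z \<in> gpiece W (shift_deg z)" | "Z = 0"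
  using assms by (auto simp: piece_E zero_prod_def split: if_splits)

text \<open>The first degree separates \<open>V\<close> from \<open>W\<close>: a vanishing sum in \<open>E\<close> gives one in \<open>V\<close>, from the indices
  with first degree \<open>0\<close>, and one in \<open>W\<close>, from those with first degree \<open>1\<close>.\<close>

lemma direct_family_piece_E: "direct_family (gpiece E)"
proof
  show "0 \<in> gpiece E z" for z
    by (simp add: piece_E zero_prod_def V.zero_mem W.zero_mem)
  show "X \<in> gpiece E z \<Longrightarrow> Y \<in> gpiece E z \<Longrightarrow> X - Y \<in> gpiece E z" for X Y z
    by (auto simp: piece_E V.diff_mem W.diff_mem split: if_splits)
  fix f assume "decomposes (gpiece E) 0 f"
  then have f: "f z \<in> gpiece E z" and S: "finite {z. f z \<noteq> 0}" and zero: "(\<Sum>z | f z \<noteq> 0. f z) = 0" for z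
    by (auto simp: decomposes_def)
  have first: "z 0 = 0" if "fst (f z) \<noteq> 0" for z
    using f[of z] that by (auto simp: piece_E split: if_splits)
  have second: "z 0 = 1" if "snd (f z) \<noteq> 0" for z
    using f[of z] that by (auto simp: piece_E split: if_splits)
  have fst_mem: "fst (f z) \<in> gpiece V (shift_deg z)" if "z 0 = 0" for z
    using f[of z] that by (auto simp: piece_E)
  have snd_mem: "snd (f z) \<in> gpiece W (shift_deg z)" if "z 0 = 1" for z
    using f[of z] that by (auto simp: piece_E)
  have inj: "inj_on shift_deg {z. f z \<noteq> 0 \<and> z 0 = a}" for a
  proof (rule inj_onI)
    fix z z' assume "z \<in> {z. f z \<noteq> 0 \<and> z 0 = a}" "z' \<in> {z. f z \<noteq> 0 \<and> z 0 = a}" "shift_deg z = shift_deg z'"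
    then have "z i = z' i" for i
      by (cases i) (auto dest: fun_cong)
    then show "z = z'" by blast
  qed
  show "f = 0"
  proof (rule ext)
    fix z
    have "(\<Sum>z | f z \<noteq> 0 \<and> z 0 = 0. fst (f z)) = (\<Sum>z | f z \<noteq> 0. fst (f z))"
      using S first by (intro sum.mono_neutral_left) auto
    also have "\<dots> = 0"
      using zero by (simp flip: fst_sum)
    finally have V: "fst (f z) = 0" if "f z \<noteq> 0" "z 0 = 0"
      using V.sum_eq_zeroD[OF _ inj[of 0], of "\<lambda>z. fst (f z)" z] S that fst_mem by simp
    have "(\<Sum>z | f z \<noteq> 0 \<and> z 0 = 1. snd (f z)) = (\<Sum>z | f z \<noteq> 0. snd (f z))"
      using S second by (intro sum.mono_neutral_left) auto
    also have "\<dots> = 0"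
      using zero by (simp flip: snd_sum)
    finally have W: "snd (f z) = 0" if "f z \<noteq> 0" "z 0 = 1"
      using W.sum_eq_zeroD[OF _ inj[of 1], of "\<lambda>z. snd (f z)" z] S that snd_mem by simp
    show "f z = 0 z"
      using V W by (cases rule: piece_E_cases[OF f[of z]]) (auto simp: prod_eq_iff)
  qed
qed

lemma graded_E: "graded E"
proof
  interpret pE: direct_family "gpiece E"
    by (rule direct_family_piece_E)
  have "(X, 0) \<in> dsum (gpiece E)" for X
    using V.in_dsum[of X]
  proof (induction rule: V.dsum_induct)
    case (add d Y Z)
    then have "(Y, 0) \<in> gpiece E (case_nat 0 d)"
      by (simp add: piece_E)
    then show ?case
      using pE.add_mem_dsum[OF pE.hom_mem_dsum add(3)] by fastforce
  qed (use pE.zero_mem_dsum in \<open>simp add: zero_prod_def\<close>)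
  moreover have "(0, Y) \<in> dsum (gpiece E)" for Y
    using W.in_dsum[of Y]
  proof (induction rule: W.dsum_induct)
    case (add d Y Z)
    then have "(0, Y) \<in> gpiece E (case_nat 1 d)"
      by (simp add: piece_E)
    then show ?case
      using pE.add_mem_dsum[OF pE.hom_mem_dsum add(3)] by fastforce
  qed (use pE.zero_mem_dsum in \<open>simp add: zero_prod_def\<close>)
  ultimately have "Z \<in> dsum (gpiece E)" for Z
    using pE.add_mem_dsum[of "(fst Z, 0)" "(0, snd Z)"] by simp
  then have "\<exists>f. decomposes (gpiece E) Z f" for Z
    unfolding dsum_def by blast
  then have "\<exists>!f. decomposes (gpiece E) Z f" for Z
    using pE.decomposes_unique by blast
  moreover have "vector_space (gscale E)"
    unfolding E_space_def using VW.p.vector_space_axioms by simp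
  moreover have "module.subspace (gscale E) (gpiece E z)" for z
  proof -
    have "V.subspace (gpiece V x)" "W.subspace (gpiece W x)" for x
      using V.graded W.graded by (auto simp: graded_space_def)
    then have "VW.p.subspace (gpiece E z)"
      using VW.subspace_Times V.subspace_single_0 W.subspace_single_0 VW.p.subspace_single_0
      by (simp add: piece_E)
    then show ?thesis by (simp add: E_space_def)
  qed
  moreover have "gpiece E z = {0}" if "z \<notin> degs (grank E)" for z
  proof -
    have "shift_deg z \<notin> degs (grank V)"
      using that by (auto simp: degs_def grank_E) (metis Suc_le_D Suc_le_mono)
    then have "gpiece V (shift_deg z) = {0}" "gpiece W (shift_deg z) = {0}"
      using V.graded W.graded same_rank by (auto simp: graded_space_def)
    then show ?thesis
      by (simp add: piece_E zero_prod_def)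
  qed
  ultimately show "graded_space (grank E) E"
    by (simp add: graded_space_def)
qed

end

sublocale graded_sum \<subseteq> E: graded "E_space V W"
  by (rule graded_E)

sublocale graded_sum \<subseteq> VW: graded_pair V W
  by unfold_locales

lemma case_nat_add: "case_nat a x + case_nat b y = (case_nat (a + b) (x + y) :: deg)"
  by (auto simp: fun_eq_iff split: nat.split)

lemma case_nat_zero: "case_nat 0 0 = (0 :: deg)"
  by (auto simp: fun_eq_iff split: nat.split)

lemma sum_list_case_nat: "sum_list (map (case_nat 0) xs) = (case_nat 0 (sum_list xs) :: deg)"
proof (induction xs)
  case Nil
  show ?case
    unfolding list.map sum_list.Nil by (rule case_nat_zero[symmetric])
next
  case (Cons x xs)
  show ?case
    unfolding list.map sum_list.Cons Cons.IH case_nat_add add_0 ..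
qed

lemma deg_inner_case_nat: "deg_inner (Suc n) (case_nat a x) (case_nat b y) = a * b + deg_inner n x y"
  by (simp add: deg_inner_def sum.lessThan_Suc_shift del: sum.lessThan_Suc)

context graded_sum
begin

lemma homogeneous_list_V:
  assumes "homogeneous_list E zs Zs" "\<forall>z\<in>set zs. z 0 = 0"
  shows "homogeneous_list V (map shift_deg zs) (map fst Zs)" "map (\<lambda>X. (X, 0)) (map fst Zs) = Zs"
    "sum_list zs = case_nat 0 (sum_list (map shift_deg zs))"
proof -
  have "homogeneous_list V (map shift_deg zs) (map fst Zs) \<and> map (\<lambda>X. (X, 0)) (map fst Zs) = Zs \<and>
      sum_list zs = case_nat 0 (sum_list (map shift_deg zs))"
    using assms unfolding homogeneous_list_def
  proof (induction rule: list_all2_induct)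
    case (Cons z zs Z Zs)
    have "z = case_nat 0 (shift_deg z)"
      using Cons(4) by (auto simp: fun_eq_iff split: nat.split)
    then have "z + case_nat 0 y = case_nat 0 (shift_deg z + y)" for y
      using case_nat_add[of 0 "shift_deg z" 0 y] by simp
    then show ?case
      using Cons by (auto simp: piece_E split: prod.split)
  qed (simp add: case_nat_zero)
  then show "homogeneous_list V (map shift_deg zs) (map fst Zs)" "map (\<lambda>X. (X, 0)) (map fst Zs) = Zs"
    "sum_list zs = case_nat 0 (sum_list (map shift_deg zs))"
    by auto
qed

text \<open>Entries of first degree other than \<open>0\<close> and \<open>1\<close> are zero. So a list without zero entries has
  nonnegative first degrees throughout, and one positive entry makes their sum positive.\<close>

lemma homogeneous_list_W:
  assumes "homogeneous_list E zs Zs" "\<exists>z\<in>set zs. z 0 \<noteq> 0"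
  shows "0 \<in> set (map fst Zs)"
    and "0 \<in> set Zs \<or> sum_list zs 0 \<ge> 1"
proof -
  have "0 \<in> set (map fst Zs) \<and> (0 \<in> set Zs \<or> sum_list zs 0 \<ge> 1)"
    if "list_all2 (\<lambda>x X. X \<in> gpiece E x) zs Zs" "\<exists>z\<in>set zs. z 0 \<noteq> 0" for zs Zs
    using that
  proof (induction rule: list_all2_induct)
    case (Cons z zs Z Zs)
    have nonneg: "0 \<in> set Zs \<or> sum_list zs 0 \<ge> 0"
      using Cons(2)
    proof (induction rule: list_all2_induct)
      case (Cons z zs Z Zs)
      then show ?case
        by (auto simp: piece_E split: if_splits)
    qed auto
    show ?case
    proof (cases "z 0 = 0")
      case True
      then show ?thesis using Cons by auto
    next
      case False
      then show ?thesis
        using Cons(1) nonneg by (auto simp: piece_E split: if_splits)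
    qed
  qed auto
  then show "0 \<in> set (map fst Zs)" and "0 \<in> set Zs \<or> sum_list zs 0 \<ge> 1"
    using assms unfolding homogeneous_list_def by blast+
qed

lemma homogeneous_list_inclusion:
  "homogeneous_list V xs Xs \<Longrightarrow> homogeneous_list E (map (case_nat 0) xs) (map (\<lambda>X. (X, 0)) Xs)"
  unfolding homogeneous_list_def by (induction rule: list_all2_induct) (auto simp: piece_E)

lemma extV_mem:
  assumes C: "C \<in> mlin V W k c"
  shows "extV C \<in> mlin E E k (case_nat 1 c)"
proof -
  note mult = VW.mlin_multilin[OF C]
  have "E.self.multilin k (extV C)"
    by (rule E.self.multilinI)
      (simp_all add: extV_def multilinear_length[OF mult] multilinear_add[OF mult]
        VW.multilin_scale[OF mult] gscale_E zero_prod_def)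
  moreover have "extV C Zs \<in> gpiece E (sum_list zs + case_nat 1 c)"
    if "length zs = k" "homogeneous_list E zs Zs" for zs Zs
  proof (cases "\<forall>z\<in>set zs. z 0 = 0")
    case True
    then show ?thesis
      using homogeneous_list_V[OF that(2) True] that(1)
        VW.mlin_hom[OF C homogeneous_list_V(1)[OF that(2) True]]
      by (simp add: extV_def case_nat_add piece_E_case_nat del: plus_fun_apply)
  next
    case False
    then have "C (map fst Zs) = 0"
      using homogeneous_list_W(1)[OF that(2)] multilinear_zero_entry[OF mult] by blast
    then show ?thesis
      using E.zero_mem by (simp add: extV_def zero_prod_def)
  qed
  ultimately show ?thesis by (simp add: mlin_def)
qed

text \<open>A map of degree \<open>1\<close> in the first coordinate sends \<open>V\<close> to \<open>W\<close> and vanishes as soon as one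
  argument lies in \<open>W\<close>, because nothing lives in first degree \<open>2\<close> or more.\<close>

lemma
  assumes K: "K \<in> mlin E E k (case_nat 1 c)"
  shows restrV_mem: "restrV K \<in> mlin V W k c" and extV_restrV: "extV (restrV K) = K"
proof -
  note mult = E.self.mlin_multilin[OF K]
  have incl: "(X + Y, 0 :: 'w) = (X, 0) + (Y, 0)" "(gscale V r X, 0) = gscale E r (X, 0)" for X Y :: 'v and r
    by (simp_all add: gscale_E)
  have "VW.multilin k (restrV K)"
    by (rule VW.multilinI)
      (simp_all add: restrV_def multilinear_length[OF mult] incl(2) del: add_Pair,
       simp_all add: multilinear_add[OF mult] E.self.multilin_scale[OF mult] incl(1)
         gscale_E[of _ "K _"] del: add_Pair)
  moreover have snd: "restrV K Xs \<in> gpiece W (sum_list xs + c)"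
    and fst: "fst (K (map (\<lambda>X. (X, 0)) Xs)) = 0"
    if "length xs = k" "homogeneous_list V xs Xs" for xs Xs
    using E.self.mlin_hom[OF K homogeneous_list_inclusion[OF that(2)]] that(1)
    by (auto simp: restrV_def sum_list_case_nat case_nat_add piece_E_case_nat simp del: plus_fun_apply)
  ultimately show mem: "restrV K \<in> mlin V W k c"
    by (simp add: mlin_def)
  show "extV (restrV K) = K"
    using E.self.mlin_multilin[OF extV_mem[OF mem]] mult
  proof (rule E.self.multilin_eqI)
    fix zs Zs assume zs: "length zs = k" "homogeneous_list E zs Zs"
    show "extV (restrV K) Zs = K Zs"
    proof (cases "\<forall>z\<in>set zs. z 0 = 0")
      case True
      then have "extV (restrV K) Zs = (0, snd (K Zs))"
        using homogeneous_list_V(2)[OF zs(2) True] by (simp add: extV_def restrV_def)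
      moreover have "fst (K Zs) = 0"
        using fst[OF _ homogeneous_list_V(1)[OF zs(2) True]] homogeneous_list_V(2)[OF zs(2) True] zs(1)
        by simp
      ultimately show ?thesis by (simp add: prod_eq_iff)
    next
      case False
      then have "restrV K (map fst Zs) = 0"
        using homogeneous_list_W(1)[OF zs(2)] multilinear_zero_entry[OF VW.mlin_multilin[OF mem]] by blast
      moreover have "K Zs = 0"
      proof (cases "0 \<in> set Zs")
        case True
        then show ?thesis using multilinear_zero_entry[OF mult] by blast
      next
        case 0: False
        then have "(sum_list zs + case_nat 1 c) 0 \<ge> 2"
          using homogeneous_list_W(2)[OF zs(2)] False by auto
        then show ?thesis
          using E.self.mlin_hom[OF K zs(2,1)] by (simp add: piece_E)
      qed
      ultimately show ?thesis by (simp add: extV_def zero_prod_def)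
    qed
  qed
qed

text \<open>Only if both arguments are in \<open>W\<close> is the value nonzero, and then their first degrees add up to \<open>2\<close>
  while the value has first degree \<open>1\<close>.\<close>

lemma extW_mem:
  assumes "\<nu> \<in> mlin W W 2 0"
  shows "extW \<nu> \<in> M_hom E (1, case_nat (-1) 0)"
proof -
  note mult = W.self.mlin_multilin[OF assms]
  have "E.self.multilin 2 (extW \<nu>)"
    by (rule E.self.multilinI)
      (simp_all add: extW_def multilinear_length[OF mult] multilinear_add[OF mult]
        W.self.multilin_scale[OF mult] gscale_E zero_prod_def)
  moreover have "extW \<nu> Zs \<in> gpiece E (sum_list zs + case_nat (-1) 0)"
    if "length zs = 2" "homogeneous_list E zs Zs" for zs Zs
  proof -
    obtain z1 z2 where zs: "zs = [z1, z2]"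
      using \<open>length zs = 2\<close> by (auto simp: length_Suc_conv numeral_2_eq_2)
    then obtain Z1 Z2 where Zs: "Zs = [Z1, Z2]" and Z: "Z1 \<in> gpiece E z1" "Z2 \<in> gpiece E z2"
      using \<open>homogeneous_list E zs Zs\<close> by (auto simp: homogeneous_list_def list_all2_Cons1)
    show ?thesis
    proof (cases "snd Z1 = 0 \<or> snd Z2 = 0")
      case True
      then have "\<nu> [snd Z1, snd Z2] = 0"
        by (intro multilinear_zero_entry[OF mult]) auto
      then show ?thesis
        using E.zero_mem by (simp add: extW_def Zs zero_prod_def)
    next
      case False
      then have "z1 0 = 1" "z2 0 = 1" "snd Z1 \<in> gpiece W (shift_deg z1)" "snd Z2 \<in> gpiece W (shift_deg z2)"
        using Z by (auto simp: piece_E split: if_splits)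
      then show ?thesis
        using W.self.mlin_hom[OF assms, of "[shift_deg z1, shift_deg z2]" "[snd Z1, snd Z2]"]
        by (simp add: zs Zs extW_def piece_E plus_fun_def)
    qed
  qed
  ultimately show ?thesis
    using E.M_hom_nat[of 2 "case_nat (-1) 0"] by (simp add: mlin_def)
qed

lemma restrV_extV: "restrV (extV C) = C"
  by (simp add: fun_eq_iff restrV_def extV_def comp_def)

lemma extV_inject: "extV C = extV C' \<longleftrightarrow> C = C'" for C C' :: "'v list \<Rightarrow> 'w"
proof
  assume "extV C = extV C'"
  then have "restrV (extV C) = restrV (extV C')" by simp
  then show "C = C'" by (simp add: restrV_extV)
qed simp

lemma extV_add: "extV (C + C') = extV C + extV C'" for C C' :: "'v list \<Rightarrow> 'w"
  by (simp add: fun_eq_iff extV_def)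

lemma extV_fscale: "extV (fscale W r C) = fscale E r (extV C)"
  by (simp add: fun_eq_iff extV_def fscale_def gscale_E)

lemma extV_zero: "extV 0 = 0"
  by (simp add: fun_eq_iff extV_def zero_prod_def)

lemma restrV_add: "restrV (K + K') = restrV K + restrV K'"
  by (simp add: fun_eq_iff restrV_def)

lemma restrV_fscale: "restrV (fscale E r K) = fscale W r (restrV K)"
  by (simp add: fun_eq_iff restrV_def fscale_def gscale_E)

lemma restrV_zero: "restrV 0 = 0"
  by (simp add: fun_eq_iff restrV_def)

abbreviation ext_deg :: "nat \<Rightarrow> deg \<Rightarrow> int \<times> deg" where
  "ext_deg k c \<equiv> (int k - 1, case_nat 1 c)"

lemma extV_hom: "C \<in> L_hom V W (k, c) \<Longrightarrow> extV C \<in> M_hom E (ext_deg k c)"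
  using extV_mem by (simp add: L_hom_def E.M_hom_nat)

lemma restrV_hom:
  assumes "K \<in> M_hom E (ext_deg k c)"
  shows "restrV K \<in> L_hom V W (k, c)" and "extV (restrV K) = K"
  using assms restrV_mem extV_restrV by (auto simp: L_hom_def E.M_hom_nat)

lemma L_space_eq: "L_space V W = dsum (L_hom V W)"
  by (simp add: L_space_def)

context
  notes plus_fun_apply [simp del] zero_fun_apply [simp del]
begin

lemma L_hom_mem_L_space: "C \<in> L_hom V W d \<Longrightarrow> C \<in> L_space V W"
  by (simp add: L_space_eq VW.L.hom_mem_dsum)

lemma L_space_zero: "0 \<in> L_space V W"
  by (simp add: L_space_eq VW.L.zero_mem_dsum)

lemma L_space_add: "C \<in> L_space V W \<Longrightarrow> C' \<in> L_space V W \<Longrightarrow> C + C' \<in> L_space V W"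
  by (simp add: L_space_eq VW.L.add_mem_dsum)

lemma L_hom_fscale: "C \<in> L_hom V W d \<Longrightarrow> fscale W r C \<in> L_hom V W d"
  by (cases d) (simp add: L_hom_def VW.mlin_fscale)

lemma L_space_induct [consumes 1, case_names zero add]:
  assumes "C \<in> L_space V W" and "Q 0"
    and "\<And>k c Y Z. Y \<in> L_hom V W (k, c) \<Longrightarrow> Z \<in> L_space V W \<Longrightarrow> Q Z \<Longrightarrow> Q (Y + Z)"
  shows "Q C"
  using assms(1) unfolding L_space_eq
proof (induction rule: VW.L.dsum_induct)
  case zero
  show ?case by (rule assms(2))
next
  case (add d Y Z)
  then show ?case
    using assms(3)[of Y "fst d" "snd d" Z] by (simp add: L_space_eq)
qed

lemma L_space_fscale: "C \<in> L_space V W \<Longrightarrow> fscale W r C \<in> L_space V W"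
  by (induction rule: L_space_induct)
    (auto simp: W.fscale_zero W.fscale_add L_space_zero intro: L_space_add L_hom_mem_L_space L_hom_fscale)

lemma extV_M_space: "C \<in> L_space V W \<Longrightarrow> extV C \<in> M_space E"
  by (induction rule: L_space_induct)
    (auto simp: extV_zero extV_add E.M_space_eq E.M.zero_mem_dsum intro: E.M.add_mem_dsum E.M.hom_mem_dsum extV_hom)

end

end

section \<open>The coboundary operator\<close>

lemma sum_closed_under_add:
  assumes "(0::'a::comm_monoid_add) \<in> A" "\<And>x y. x \<in> A \<Longrightarrow> y \<in> A \<Longrightarrow> x + y \<in> A" "\<And>i. i \<in> I \<Longrightarrow> f i \<in> A"
  shows "sum f I \<in> A"
  using assms(3) by (induction I rule: infinite_finite_induct) (auto intro: assms(1,2))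

text \<open>A structure \<open>P\<close> with \<open>[P, P]\<^sup>\<Delta> = 0\<close> amounts to an associative algebra \<open>V\<close> and a bimodule \<open>W\<close>. The
  characteristic enters through the division by \<open>2\<close> that yields \<open>[P, [P, K]]\<^sup>\<Delta> = 0\<close>.\<close>

locale multigraded_bimodule = graded_sum V W
  for V :: "('k::field, 'v::ab_group_add) gspace" and W :: "('k, 'w::ab_group_add) gspace" +
  fixes P :: "('v \<times> 'w) list \<Rightarrow> 'v \<times> 'w"
  assumes two_nonzero: "(2::'k) \<noteq> 0"
    and P: "P \<in> M_hom (E_space V W) (1, 0)"
    and PP: "bracket (E_space V W) P P = 0"
begin

context
  notes plus_fun_apply [simp del] zero_fun_apply [simp del]
begin

abbreviation "\<delta> \<equiv> delta V W P"

abbreviation "cobound \<equiv> coboundaries V W P"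

abbreviation "cls \<equiv> coh_class V W P"

lemma P_M_space: "P \<in> M_space E"
  using P by (simp add: E.M_space_eq E.M.hom_mem_dsum)

lemma delta_hom:
  assumes "C \<in> L_hom V W (k, c)"
  shows "\<delta> C \<in> L_hom V W (Suc k, c)" and "extV (\<delta> C) = bracket E P (extV C)"
proof -
  have "(1, 0) + ext_deg k c = ext_deg (Suc k) c"
    by simp
  then have "bracket E P (extV C) \<in> M_hom E (ext_deg (Suc k) c)"
    using E.bracket_mem[OF P extV_hom[OF assms]] by metis
  then show "\<delta> C \<in> L_hom V W (Suc k, c)" and "extV (\<delta> C) = bracket E P (extV C)"
    unfolding delta_def by (rule restrV_hom)+
qed

lemma delta_zero: "\<delta> 0 = 0"
  by (simp add: delta_def extV_zero E.bracket_zero_right restrV_zero)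

lemma delta_add: "C \<in> L_space V W \<Longrightarrow> C' \<in> L_space V W \<Longrightarrow> \<delta> (C + C') = \<delta> C + \<delta> C'"
  by (simp add: delta_def extV_add E.bracket_add_right P_M_space extV_M_space restrV_add)

lemma delta_fscale: "C \<in> L_space V W \<Longrightarrow> \<delta> (fscale W r C) = fscale W r (\<delta> C)"
  by (simp add: delta_def extV_fscale E.bracket_fscale_right P_M_space extV_M_space restrV_fscale)

lemma
  assumes "C \<in> L_space V W"
  shows delta_mem: "\<delta> C \<in> L_space V W" and extV_delta: "extV (\<delta> C) = bracket E P (extV C)"
proof -
  have "\<delta> C \<in> L_space V W \<and> extV (\<delta> C) = bracket E P (extV C)"
    using assms
  proof (induction rule: L_space_induct)
    case zero
    then show ?case
      by (simp add: delta_zero L_space_zero extV_zero E.bracket_zero_right)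
  next
    case (add k c Y Z)
    then show ?case
      using delta_hom[OF add(1)] L_hom_mem_L_space
      by (simp add: delta_add extV_add L_space_add E.bracket_add_right P_M_space extV_M_space)
  qed
  then show "\<delta> C \<in> L_space V W" and "extV (\<delta> C) = bracket E P (extV C)"
    by auto
qed

lemma differential: "differential_on (fscale E) (M_space E) (bracket E P)"
  using E.bracket_square_zero[OF two_nonzero P PP] P_M_space
  by (simp add: differential_on_def E.bracket_add_right E.bracket_fscale_right E.bracket_mem_M_space)

end

lemma rho_homogeneous:
  assumes X: "X \<in> gpiece V x" and Y: "Y \<in> gpiece W y"
  shows "rho V W P X Y = gscale W ((-1) powi deg_inner (grank V) x y) (snd (P [(0, Y), (X, 0)]))"
proof -
  have mult: "E.self.multilin 2 P"
    using E.M_hom_multilin[OF P] by simp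
  have P0: "P [(0, 0), Z] = 0" "P [Z, (0, 0)] = 0" for Z
    by (intro multilinear_zero_entry[OF mult]; simp add: zero_prod_def)+
  have "rho V W P X Y = (\<Sum>y | component (gpiece W) Y y \<noteq> 0.
      gscale W ((-1) powi deg_inner (grank V) x y) (snd (P [(0, component (gpiece W) Y y), (X, 0)])))"
    unfolding rho_def by (rule V.extension_hom[OF X]) (simp add: P0)
  also have "\<dots> = gscale W ((-1) powi deg_inner (grank V) x y) (snd (P [(0, Y), (X, 0)]))"
    by (rule W.extension_hom[OF Y]) (simp add: P0)
  finally show ?thesis .
qed

lemma sum_lessThan_2: "(\<Sum>i<2::nat. f i) = f 0 + f 1" for f :: "nat \<Rightarrow> 'c::comm_monoid_add"
  by (simp add: numeral_2_eq_2)

text \<open>Inserting \<open>P\<close> into \<open>C\<close> gives the inner terms, where \<open>P\<close> has weight \<open>0\<close> and contributes only the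
  sign \<open>(-1)\<^sup>i\<close>. Inserting \<open>C\<close> into the binary \<open>P\<close> is possible at position \<open>0\<close>, which gives \<open>P(C, X\<^sub>k)\<close>
  and hence the \<open>\<rho>\<close> term, and at position \<open>1\<close>, which gives \<open>P(X\<^sub>0, C)\<close> and hence the \<open>\<lambda>\<close> term. The
  remaining work is the comparison of signs.\<close>

lemma delta_formula:
  assumes C: "C \<in> L_hom V W (k, c)" and len: "length xs = Suc k" and Xs: "homogeneous_list V xs Xs"
  shows "\<delta> C Xs =
    - (gscale W ((-1) powi deg_inner (grank V) (xs ! 0) c) (lam P (Xs ! 0) (C (tl Xs)))
       - (\<Sum>i<k. gscale W ((-1) ^ i) (C (take i Xs @ [mu P (Xs ! i) (Xs ! Suc i)] @ drop (i + 2) Xs)))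
       + gscale W ((-1) powi (int k + 1 + deg_inner (grank V) (sum_list (take k xs) + c) (xs ! k)))
           (rho V W P (Xs ! k) (C (take k Xs))))"
proof -
  define Zs where "Zs = map (\<lambda>X. (X, 0 :: 'w)) Xs"
  define zs where "zs = map (case_nat 0) xs"
  have lX: "length Xs = Suc k"
    using homogeneous_list_length[OF Xs] len by simp
  have Zs: "homogeneous_list E zs Zs"
    unfolding zs_def Zs_def by (rule homogeneous_list_inclusion[OF Xs])
  have lZ: "length Zs + 1 = 2 + k" "length Zs + 1 = k + 2"
    using lX by (simp_all add: Zs_def)
  have P2: "P \<in> mlin E E 2 0"
    using P E.M_hom_nat[of 2 0] by simp
  have eC: "extV C \<in> mlin E E k (case_nat 1 c)"
    using C by (simp add: L_hom_def extV_mem)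
  have C': "C \<in> mlin V W k c"
    using C by (simp add: L_hom_def)
  define S where "S = deg_inner (grank V) (sum_list (take k xs) + c) (xs ! k)"
  define T where "T = deg_inner (grank V) (xs ! 0) c"
  define R where "R = snd (P [(0, C (take k Xs)), (Xs ! k, 0)])"
  define Q where "Q = lam P (Xs ! 0) (C (tl Xs))"
  have d1: "(1, 0) = (int 2 - 1, 0 :: deg)" by simp
  have "snd (j_map E (1, 0) P (ext_deg k c) (extV C) Zs) =
      (\<Sum>i<k. gscale W ((-1) ^ i) (C (take i Xs @ [mu P (Xs ! i) (Xs ! Suc i)] @ drop (i + 2) Xs)))"
  proof -
    have "C (map fst (contract 2 P i Zs)) = C (take i Xs @ [mu P (Xs ! i) (Xs ! Suc i)] @ drop (i + 2) Xs)"
      if "i < k" for i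
    proof -
      have "drop i Xs = Xs ! i # Xs ! Suc i # drop (i + 2) Xs"
        using that lX by (simp add: Cons_nth_drop_Suc)
      then show ?thesis
        by (simp add: contract_def Zs_def take_map drop_map comp_def mu_def)
    qed
    then show ?thesis
      unfolding d1 E.j_map_nat_homogeneous[OF P2 eC Zs] E.j_formula_nat if_P[OF lZ(1)]
      by (simp add: snd_sum gscale_E extV_def power_int_of_nat)
  qed
  moreover have "snd (j_map E (ext_deg k c) (extV C) (1, 0) P Zs) =
      R + gscale W ((-1) powi (int k - 1 + T)) Q"
  proof -
    have "drop k Xs = [Xs ! k]"
      using Cons_nth_drop_Suc[of k Xs] lX by simp
    then have 0: "contract k (extV C) 0 Zs = [(0, C (take k Xs)), (Xs ! k, 0)]"
      by (simp add: contract_def Zs_def extV_def take_map drop_map comp_def)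
    obtain X Ys where "Xs = X # Ys"
      using lX by (cases Xs) auto
    then have 1: "contract k (extV C) 1 Zs = [(Xs ! 0, 0), (0, C (tl Xs))]"
      using lX by (simp add: contract_def Zs_def extV_def take_map drop_map comp_def)
    obtain x ys where x: "xs = x # ys"
      using len by (cases xs) auto
    have 2: "deg_inner (Suc (grank V)) (case_nat 1 c) (0 + sum_list (take 1 zs)) = T"
      by (simp add: zs_def x T_def deg_inner_case_nat deg_inner_commute[of _ c])
    show ?thesis
      unfolding d1 E.j_map_nat_homogeneous[OF eC P2 Zs] E.j_formula_nat if_P[OF lZ(2)] sum_lessThan_2 0 1
        grank_E 2
      by (simp add: gscale_E R_def Q_def lam_def)
  qed
  moreover have "rho V W P (Xs ! k) (C (take k Xs)) = gscale W ((-1) powi S) R"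
  proof -
    have "Xs ! k \<in> gpiece V (xs ! k)"
      using Xs lX by (auto simp: homogeneous_list_def list_all2_conv_all_nth)
    moreover have "C (take k Xs) \<in> gpiece W (sum_list (take k xs) + c)"
      using len by (intro VW.mlin_hom[OF C' homogeneous_list_take[OF Xs]]) simp
    ultimately show ?thesis
      by (simp add: rho_homogeneous R_def S_def deg_inner_commute[of _ "xs ! k"])
  qed
  moreover have "\<delta> C Xs = snd (j_map E (1, 0) P (ext_deg k c) (extV C) Zs) -
      gscale W ((-1) powi (int k - 1)) (snd (j_map E (ext_deg k c) (extV C) (1, 0) P Zs))"
    unfolding delta_def E.bracket_homogeneous[OF P extV_hom[OF C]] E.bracket_hom_eq
    by (simp add: restrV_def Zs_def fscale_def gscale_E koszul_sign_def)
  moreover have "(-1) powi (int k - 1) * (-1) powi (int k - 1 + T) = ((-1) powi T :: 'k)"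
    unfolding sign_add[symmetric] by (rule sign_eqI) simp
  moreover have "(-1) powi (int k + 1 + S) * (-1) powi S = ((-1) powi (int k - 1) :: 'k)"
    unfolding sign_add[symmetric] by (rule sign_eqI) simp
  ultimately show ?thesis
    unfolding S_def[symmetric] T_def[symmetric] Q_def[symmetric]
    by (simp add: W.scale_right_distrib)
qed

section \<open>The graded complex and its cohomology\<close>

context
  notes plus_fun_apply [simp del] zero_fun_apply [simp del]
begin

lemma L_space_diff: "C \<in> L_space V W \<Longrightarrow> C' \<in> L_space V W \<Longrightarrow> C - C' \<in> L_space V W"
  by (simp add: L_space_eq VW.L.component_diff(2))

lemma delta_diff: "C \<in> L_space V W \<Longrightarrow> C' \<in> L_space V W \<Longrightarrow> \<delta> (C - C') = \<delta> C - \<delta> C'"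
  using delta_add[of "C - C'" C'] L_space_diff[of C C'] by simp

lemma cocycles_L_space: "C \<in> cocycles V W P \<Longrightarrow> C \<in> L_space V W"
  by (simp add: cocycles_def)

lemma cocycles_zero: "0 \<in> cocycles V W P"
  by (simp add: cocycles_def L_space_zero delta_zero)

lemma cocycles_add: "C \<in> cocycles V W P \<Longrightarrow> C' \<in> cocycles V W P \<Longrightarrow> C + C' \<in> cocycles V W P"
  by (simp add: cocycles_def L_space_add delta_add)

lemma cocycles_fscale: "C \<in> cocycles V W P \<Longrightarrow> fscale W r C \<in> cocycles V W P"
  by (simp add: cocycles_def L_space_fscale delta_fscale W.fscale_zero)

lemma coboundaries_zero: "0 \<in> cobound"
  using delta_zero L_space_zero by (force simp: coboundaries_def)

lemma coboundaries_diff: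
  assumes "B \<in> cobound" "B' \<in> cobound"
  shows "B - B' \<in> cobound"
proof -
  obtain D D' where "D \<in> L_space V W" "B = \<delta> D" "D' \<in> L_space V W" "B' = \<delta> D'"
    using assms by (auto simp: coboundaries_def)
  then show ?thesis
    unfolding coboundaries_def by (intro image_eqI[of _ _ "D - D'"]) (simp_all add: delta_diff L_space_diff)
qed

lemma coboundaries_uminus: "B \<in> cobound \<Longrightarrow> - B \<in> cobound"
  using coboundaries_diff[OF coboundaries_zero, of B] by simp

lemma coboundaries_add: "B \<in> cobound \<Longrightarrow> B' \<in> cobound \<Longrightarrow> B + B' \<in> cobound"
  using coboundaries_diff[of B "- B'"] coboundaries_uminus by simp

lemma coboundaries_sum: "(\<And>i. i \<in> I \<Longrightarrow> f i \<in> cobound) \<Longrightarrow> sum f I \<in> cobound"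
  using sum_closed_under_add[of cobound I f] coboundaries_zero coboundaries_add by blast

end

end

context multigraded_bimodule
begin

context
  notes plus_fun_apply [simp del] zero_fun_apply [simp del]
begin

abbreviation "hcomp \<equiv> component (L_hom V W)"

lemma component_L_hom: "C \<in> L_space V W \<Longrightarrow> hcomp C d \<in> L_hom V W d"
  by (simp add: L_space_eq VW.L.component_mem)

lemma component_L_space: "C \<in> L_space V W \<Longrightarrow> hcomp C d \<in> L_space V W"
  by (rule L_hom_mem_L_space[OF component_L_hom])

lemma component_delta:
  assumes "C \<in> L_space V W"
  shows "hcomp (\<delta> C) (Suc k, c) = \<delta> (hcomp C (k, c))"
proof -
  have "hcomp (\<delta> C) ((\<lambda>(k, c). (Suc k, c)) (k, c)) = \<delta> (hcomp C (k, c))"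
    using assms VW.L.direct_family_axioms
    by (intro VW.L.component_map(1)) (auto simp: L_space_eq[symmetric] delta_add delta_hom inj_def)
  then show ?thesis by simp
qed

lemma component_cocycle:
  assumes "C \<in> cocycles V W P"
  shows "hcomp C d \<in> cocycles V W P"
proof (cases d)
  case (Pair k c)
  have C: "C \<in> L_space V W" "\<delta> C = 0"
    using assms by (simp_all add: cocycles_def)
  have "\<delta> (hcomp C (k, c)) = hcomp 0 (Suc k, c)"
    using component_delta[OF C(1), of k c] C(2) by simp
  then show ?thesis
    using C Pair by (simp add: cocycles_def component_L_space VW.L.component_zero zero_fun_apply)
qed

text \<open>For homogeneous \<open>D\<close> the component of \<open>\<delta> D\<close> in any degree is \<open>\<delta> D\<close> or \<open>0\<close>.\<close>

lemma component_coboundary: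
  assumes "B \<in> cobound"
  shows "hcomp B d \<in> cobound"
proof -
  obtain D where D: "D \<in> L_space V W" "B = \<delta> D"
    using assms by (auto simp: coboundaries_def)
  have "hcomp (\<delta> D) d \<in> cobound"
    using D(1)
  proof (induction rule: L_space_induct)
    case zero
    have "hcomp 0 d = 0"
      by (simp add: VW.L.component_zero zero_fun_apply)
    then show ?case
      by (simp add: delta_zero coboundaries_zero)
  next
    case (add k c Y Z)
    have Y: "Y \<in> L_space V W"
      by (rule L_hom_mem_L_space[OF add(1)])
    have "hcomp (\<delta> Y) d = (if d = (Suc k, c) then \<delta> Y else 0)"
      using VW.L.component_hom[OF delta_hom(1)[OF add(1)]] by simp
    then have "hcomp (\<delta> Y) d \<in> cobound"
      using Y coboundaries_zero by (simp add: coboundaries_def)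
    moreover have "hcomp (\<delta> (Y + Z)) d = hcomp (\<delta> Y) d + hcomp (\<delta> Z) d"
      using VW.L.component_add[of "\<delta> Y" "\<delta> Z"] delta_mem Y add(2)
      by (simp add: delta_add L_space_eq plus_fun_apply)
    ultimately show ?case
      using add(3) coboundaries_add by simp
  qed
  then show ?thesis using D by simp
qed

lemma coboundaries_fscale:
  assumes "B \<in> cobound"
  shows "fscale W r B \<in> cobound"
proof -
  obtain D where "D \<in> L_space V W" "B = \<delta> D"
    using assms by (auto simp: coboundaries_def)
  then show ?thesis
    unfolding coboundaries_def
    by (intro image_eqI[of _ _ "fscale W r D"]) (simp_all add: delta_fscale L_space_fscale)
qed

lemma cls_eq_iff: "cls C = cls C' \<longleftrightarrow> C - C' \<in> cobound"
proof
  assume "cls C = cls C'"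
  moreover have "C \<in> cls C"
    unfolding coh_class_def using set_plus_intro2[OF coboundaries_zero, of C] by simp
  ultimately show "C - C' \<in> cobound"
    unfolding coh_class_def by (simp add: set_plus_imp_minus)
next
  assume *: "C - C' \<in> cobound"
  have "D - C \<in> cobound \<longleftrightarrow> D - C' \<in> cobound" for D
    using coboundaries_add[OF _ *, of "D - C"] coboundaries_diff[OF _ *, of "D - C'"] by auto
  then show "cls C = cls C'"
    unfolding coh_class_def set_eq_iff set_minus_plus[symmetric] by simp
qed

lemma cls_zero: "cls 0 = cobound"
  by (simp add: coh_class_def)

lemma coboundaries_plus: "cobound + cobound = cobound"
  using set_zero_plus2[OF coboundaries_zero, of cobound] coboundaries_add by (auto elim: set_plus_elim)

lemma cls_add: "cls C + cls C' = cls (C + C')"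
  by (simp add: coh_class_def set_plus_rearrange coboundaries_plus)

lemma cls_sum: "finite S \<Longrightarrow> cobound + (\<Sum>d\<in>S. cls (g d)) = cls (sum g S)"
proof (induction S rule: finite_induct)
  case empty
  then show ?case by (simp add: cls_zero)
next
  case (insert d S)
  then show ?case
    by (simp add: add.left_commute[of cobound] cls_add)
qed

lemma cls_fscale: "coh_scale V W P r (cls C) = cls (fscale W r C)"
proof -
  have "fscale W r ` cls C + cobound = cls (fscale W r C)"
  proof (intro set_eqI iffI)
    fix D assume "D \<in> fscale W r ` cls C + cobound"
    then obtain B B' where "B \<in> cobound" "B' \<in> cobound" "D = fscale W r (C + B) + B'"
      by (auto simp: coh_class_def elt_set_plus_def elim!: set_plus_elim)
    then show "D \<in> cls (fscale W r C)"
      by (simp add: coh_class_def W.fscale_add add.assoc set_plus_intro2 coboundaries_add coboundaries_fscale)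
  next
    fix D assume "D \<in> cls (fscale W r C)"
    then obtain B where "B \<in> cobound" "D = fscale W r C + B"
      by (auto simp: coh_class_def elt_set_plus_def)
    moreover have "C \<in> cls C"
      using cls_eq_iff[of C C] set_plus_intro2[OF coboundaries_zero, of C] by (simp add: coh_class_def)
    ultimately show "D \<in> fscale W r ` cls C + cobound"
      by blast
  qed
  then show ?thesis by (simp add: coh_scale_def)
qed

lemma cls_H_space: "C \<in> cocycles V W P \<Longrightarrow> cls C \<in> H_space V W P"
  by (simp add: H_space_def)

lemma H_space_cases:
  assumes "A \<in> H_space V W P"
  obtains C where "C \<in> cocycles V W P" "A = cls C"
  using assms by (auto simp: H_space_def)

text \<open>The class of \<open>C\<close> decomposes into the classes of the components of \<open>C\<close>, which are cocycles. The
  decomposition is unique because the difference of two representatives is a coboundary, and so are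
  its components.\<close>

lemma H_graded: "H_graded V W P"
  unfolding H_graded_def
proof
  fix A assume "A \<in> H_space V W P"
  then obtain C where C: "C \<in> cocycles V W P" and A: "A = cls C"
    by (rule H_space_cases)
  note CL = cocycles_L_space[OF C]
  let ?R = "\<lambda>f. (\<forall>d. f d \<in> H_hom V W P d) \<and> finite {d. f d \<noteq> cobound} \<and>
      A = cobound + (\<Sum>d | f d \<noteq> cobound. f d)"
  show "\<exists>!f. ?R f"
  proof (rule ex1I)
    let ?f = "\<lambda>d. cls (hcomp C d)"
    let ?S = "{d. ?f d \<noteq> cobound}" and ?T = "{d. hcomp C d \<noteq> 0}"
    have ST: "?S \<subseteq> ?T" and T: "finite ?T"
      using CL by (auto simp: cls_zero L_space_eq VW.L.finite_component)
    then have S: "finite ?S"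
      by (rule finite_subset)
    have "hcomp C d \<in> cobound" if "d \<notin> ?S" for d
      using that cls_eq_iff[of "hcomp C d" 0] by (simp add: cls_zero)
    then have "sum (hcomp C) (?T - ?S) \<in> cobound"
      by (intro coboundaries_sum) blast
    moreover have "C = sum (hcomp C) ?T"
      using VW.L.sum_component CL by (simp add: L_space_eq)
    moreover have "sum (hcomp C) ?T = sum (hcomp C) (?T - ?S) + sum (hcomp C) ?S"
      using sum.subset_diff[OF ST T] .
    ultimately have "C - sum (hcomp C) ?S \<in> cobound"
      by (metis add_diff_cancel_right')
    then have "A = cls (sum (hcomp C) ?S)"
      unfolding A cls_eq_iff .
    then show "?R ?f"
      using S cls_sum[OF S, of "hcomp C"] component_cocycle[OF C] component_L_hom[OF CL]
      by (simp add: H_hom_def)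
  next
    fix f assume f: "?R f"
    let ?S = "{d. f d \<noteq> cobound}"
    have "\<exists>g. g \<in> L_hom V W d \<and> f d = cls g" for d
    proof -
      have "f d \<in> H_hom V W P d"
        using f by blast
      then show ?thesis
        unfolding H_hom_def by blast
    qed
    then obtain g where g: "\<And>d. g d \<in> L_hom V W d" "\<And>d. f d = cls (g d)"
      by metis
    have S: "finite ?S"
      using f by blast
    have "A = cobound + (\<Sum>d\<in>?S. cls (g d))"
      using f g(2) by simp
    then have "C - sum g ?S \<in> cobound"
      unfolding A cls_sum[OF S] cls_eq_iff .
    then have *: "hcomp (C - sum g ?S) d \<in> cobound" for d
      by (rule component_coboundary)
    show "f = (\<lambda>d. cls (hcomp C d))"
    proof
      fix d
      have eq: "hcomp (C - sum g ?S) d = hcomp C d - (if d \<in> ?S then g d else 0)"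
        using VW.L.component_diff(1)[of C "sum g ?S"] CL S g
          VW.L.sum_mem_dsum[of ?S g] VW.L.component_sum[of ?S g]
        by (simp add: L_space_eq)
      have "cls (hcomp C d) = cls (if d \<in> ?S then g d else 0)"
        unfolding cls_eq_iff using *[of d, unfolded eq] .
      then show "f d = cls (hcomp C d)"
        using g(2) by (simp add: cls_zero split: if_splits)
    qed
  qed
qed

end

end

section \<open>The product \<open>\<bullet>\<close>\<close>

locale multigraded_bimodule_product = multigraded_bimodule V W P
  for V :: "('k::field, 'v::ab_group_add) gspace" and W :: "('k, 'w::ab_group_add) gspace" and P +
  fixes \<nu> :: "'w list \<Rightarrow> 'w"
  assumes nu: "\<nu> \<in> mlin W W 2 0"
begin

context
  notes plus_fun_apply [simp del] zero_fun_apply [simp del]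
begin

abbreviation bullet_infix (infixl "\<bullet>" 70) where "C1 \<bullet> C2 \<equiv> bullet V W \<nu> C1 C2"

lemmas extW_hom = extW_mem[OF nu]

lemma extW_M_space: "extW \<nu> \<in> M_space E"
  using extW_hom by (simp add: E.M_space_eq E.M.hom_mem_dsum)

text \<open>The inner bracket has first degree \<open>0\<close> and therefore is no element of \<open>L(V, W)\<close>; it is handled in
  \<open>M(E)\<close>.\<close>

lemma inner_M_space: "C \<in> L_space V W \<Longrightarrow> bracket E (extV C) (extW \<nu>) \<in> M_space E"
  by (simp add: E.bracket_mem_M_space extV_M_space extW_M_space)

lemma inner_hom: "C \<in> L_hom V W (k, c) \<Longrightarrow>
    bracket E (extV C) (extW \<nu>) \<in> M_hom E (ext_deg k c + (1, case_nat (-1) 0))"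
  by (rule E.bracket_mem[OF extV_hom extW_hom])

lemma prod_hom:
  assumes "C1 \<in> L_hom V W (k1, c1)" "C2 \<in> L_hom V W (k2, c2)"
  shows "C1 \<bullet> C2 \<in> L_hom V W (k1 + k2, c1 + c2)"
    and "extV (C1 \<bullet> C2) = bracket E (extV C1) (bracket E (extV C2) (extW \<nu>))"
proof -
  have "ext_deg k1 c1 + (ext_deg k2 c2 + (1, case_nat (-1) 0)) = ext_deg (k1 + k2) (c1 + c2)"
    by (simp add: case_nat_add)
  then have "bracket E (extV C1) (bracket E (extV C2) (extW \<nu>)) \<in> M_hom E (ext_deg (k1 + k2) (c1 + c2))"
    using E.bracket_mem[OF extV_hom[OF assms(1)] inner_hom[OF assms(2)]] by metis
  then show "C1 \<bullet> C2 \<in> L_hom V W (k1 + k2, c1 + c2)"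
    and "extV (C1 \<bullet> C2) = bracket E (extV C1) (bracket E (extV C2) (extW \<nu>))"
    unfolding bullet_def by (rule restrV_hom)+
qed

lemma prod_add_left:
  "C \<in> L_space V W \<Longrightarrow> C' \<in> L_space V W \<Longrightarrow> D \<in> L_space V W \<Longrightarrow> (C + C') \<bullet> D = C \<bullet> D + C' \<bullet> D"
  by (simp add: bullet_def extV_add E.bracket_add_left extV_M_space inner_M_space restrV_add)

lemma prod_add_right:
  "C \<in> L_space V W \<Longrightarrow> C' \<in> L_space V W \<Longrightarrow> D \<in> L_space V W \<Longrightarrow> D \<bullet> (C + C') = D \<bullet> C + D \<bullet> C'"
  by (simp add: bullet_def extV_add E.bracket_add_left E.bracket_add_right extV_M_space extW_M_space
      inner_M_space restrV_add)

lemma prod_fscale_left: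
  "C \<in> L_space V W \<Longrightarrow> D \<in> L_space V W \<Longrightarrow> fscale W r C \<bullet> D = fscale W r (C \<bullet> D)"
  by (simp add: bullet_def extV_fscale E.bracket_fscale_left extV_M_space inner_M_space restrV_fscale)

lemma prod_fscale_right:
  "C \<in> L_space V W \<Longrightarrow> D \<in> L_space V W \<Longrightarrow> D \<bullet> fscale W r C = fscale W r (D \<bullet> C)"
  by (simp add: bullet_def extV_fscale E.bracket_fscale_left E.bracket_fscale_right extV_M_space
      extW_M_space inner_M_space restrV_fscale)

lemma prod_zero: "0 \<bullet> D = 0" "D \<bullet> 0 = 0"
  by (simp_all add: bullet_def extV_zero E.bracket_zero_left E.bracket_zero_right restrV_zero)

lemma
  assumes C1: "C1 \<in> L_space V W" and C2: "C2 \<in> L_space V W"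
  shows prod_mem: "C1 \<bullet> C2 \<in> L_space V W"
    and extV_prod: "extV (C1 \<bullet> C2) = bracket E (extV C1) (bracket E (extV C2) (extW \<nu>))"
proof -
  have hom: "Y \<bullet> C2 \<in> L_space V W \<and> extV (Y \<bullet> C2) = bracket E (extV Y) (bracket E (extV C2) (extW \<nu>))"
    if Y: "Y \<in> L_hom V W (k, c)" for Y k c
    using C2
  proof (induction rule: L_space_induct)
    case zero
    then show ?case
      by (simp add: prod_zero L_space_zero extV_zero E.bracket_zero_left E.bracket_zero_right)
  next
    case (add l e Y' Z)
    then show ?case
      using prod_hom[OF Y add(1)] L_hom_mem_L_space[OF add(1)] L_hom_mem_L_space[OF Y] L_hom_mem_L_space
      by (simp add: prod_add_right extV_add L_space_add E.bracket_add_left E.bracket_add_right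
          extV_M_space extW_M_space inner_M_space)
  qed
  have "C1 \<bullet> C2 \<in> L_space V W \<and> extV (C1 \<bullet> C2) = bracket E (extV C1) (bracket E (extV C2) (extW \<nu>))"
    using C1
  proof (induction rule: L_space_induct)
    case zero
    then show ?case
      by (simp add: prod_zero L_space_zero extV_zero E.bracket_zero_left)
  next
    case (add k c Y Z)
    then show ?case
      using hom[OF add(1)] L_hom_mem_L_space[OF add(1)] C2
      by (simp add: prod_add_left extV_add L_space_add E.bracket_add_left extV_M_space inner_M_space)
  qed
  then show "C1 \<bullet> C2 \<in> L_space V W"
    and "extV (C1 \<bullet> C2) = bracket E (extV C1) (bracket E (extV C2) (extW \<nu>))"
    by auto
qed

lemma graded_product: "graded_product_on (fscale W) (L_space V W) (L_hom V W) (bullet V W \<nu>)"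
  unfolding graded_product_on_def
  by (simp add: prod_mem prod_add_left prod_add_right prod_fscale_left prod_fscale_right prod_hom(1))

context
  assumes P_nu: "bracket E P (extW \<nu>) = 0"
begin

text \<open>Two applications of the Jacobi identity:
  \<open>[P, [C\<^sub>1, [C\<^sub>2, \<nu>]]] = [[P, C\<^sub>1], [C\<^sub>2, \<nu>]] \<plusminus> [C\<^sub>1, [P, [C\<^sub>2, \<nu>]]]\<close> and
  \<open>[P, [C\<^sub>2, \<nu>]] = [[P, C\<^sub>2], \<nu>] \<plusminus> [C\<^sub>2, [P, \<nu>]]\<close>, where the last term is zero.\<close>

lemma delta_prod_hom:
  assumes C1: "C1 \<in> L_hom V W (k1, c1)" and C2: "C2 \<in> L_hom V W (k2, c2)"
  shows "\<delta> (C1 \<bullet> C2) = \<delta> C1 \<bullet> C2 + fscale W ((-1) powi (int k1 - 1)) (C1 \<bullet> \<delta> C2)"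
proof -
  note L = L_hom_mem_L_space[OF C1] L_hom_mem_L_space[OF C2]
  have s: "koszul_sign E (1, 0) (ext_deg k c) = (-1) powi (int k - 1)" for k c
    by (simp add: koszul_sign_def)
  have inner: "bracket E P (bracket E (extV C2) (extW \<nu>)) = bracket E (extV (\<delta> C2)) (extW \<nu>)"
    using E.bracket_jacobi[OF P extV_hom[OF C2] extW_hom] L
    by (simp add: P_nu E.bracket_zero_right E.fscale_zero extV_delta)
  have "extV (\<delta> (C1 \<bullet> C2)) = bracket E P (bracket E (extV C1) (bracket E (extV C2) (extW \<nu>)))"
    using L by (simp add: extV_delta extV_prod prod_mem)
  also have "\<dots> = bracket E (extV (\<delta> C1)) (bracket E (extV C2) (extW \<nu>)) +
      fscale E ((-1) powi (int k1 - 1)) (bracket E (extV C1) (bracket E (extV (\<delta> C2)) (extW \<nu>)))"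
    using E.bracket_jacobi[OF P extV_hom[OF C1] inner_hom[OF C2]] L by (simp add: s inner extV_delta)
  also have "\<dots> = extV (\<delta> C1 \<bullet> C2 + fscale W ((-1) powi (int k1 - 1)) (C1 \<bullet> \<delta> C2))"
    using L by (simp add: extV_add extV_fscale extV_prod delta_mem)
  finally show ?thesis by (simp only: extV_inject)
qed

lemma delta_prod:
  assumes C1: "C1 \<in> L_hom V W (k1, c1)" and C2: "C2 \<in> L_space V W"
  shows "\<delta> (C1 \<bullet> C2) = \<delta> C1 \<bullet> C2 + fscale W ((-1) powi (int k1 - 1)) (C1 \<bullet> \<delta> C2)"
  using C2
proof (induction rule: L_space_induct)
  case zero
  then show ?case by (simp add: prod_zero delta_zero W.fscale_zero)
next
  case (add k c Y Z)
  then show ?case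
    using delta_prod_hom[OF C1 add(1)] L_hom_mem_L_space[OF add(1)] L_hom_mem_L_space[OF C1]
    by (simp add: prod_add_right delta_add prod_mem delta_mem W.fscale_add ac_simps)
qed

text \<open>The sign in the derivation rule depends on the arity of the left factor, which is only defined for
  homogeneous cochains; this rule reduces statements about cocycles to homogeneous ones.\<close>

lemma cocycles_induct [consumes 1, case_names zero add]:
  assumes "C \<in> cocycles V W P" and "Q 0"
    and "\<And>k c Y Z. Y \<in> L_hom V W (k, c) \<Longrightarrow> Y \<in> cocycles V W P \<Longrightarrow> Z \<in> cocycles V W P \<Longrightarrow> Q Z \<Longrightarrow> Q (Y + Z)"
  shows "Q C"
proof -
  have "sum (hcomp C) S \<in> cocycles V W P \<and> Q (sum (hcomp C) S)" if "finite S" for S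
    using that
  proof induction
    case empty
    then show ?case using assms(2) cocycles_zero by simp
  next
    case (insert d S)
    then show ?case
      using assms(3)[of "hcomp C d" "fst d" "snd d" "sum (hcomp C) S"] component_cocycle[OF assms(1), of d]
        component_L_hom[OF cocycles_L_space[OF assms(1)], of d] cocycles_add
      by simp
  qed
  moreover have "finite {d. hcomp C d \<noteq> 0}" "C = sum (hcomp C) {d. hcomp C d \<noteq> 0}"
    using cocycles_L_space[OF assms(1)] VW.L.finite_component VW.L.sum_component by (auto simp: L_space_eq)
  ultimately show ?thesis by metis
qed

lemma prod_cocycle:
  assumes "C1 \<in> cocycles V W P" "C2 \<in> cocycles V W P"
  shows "C1 \<bullet> C2 \<in> cocycles V W P"
  using assms(1)
proof (induction rule: cocycles_induct)
  case zero
  show ?case by (simp add: prod_zero cocycles_zero)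
next
  case (add k c Y Z)
  have "\<delta> (Y \<bullet> C2) = 0"
    using delta_prod[OF add(1) cocycles_L_space[OF assms(2)]] add(2) assms(2)
    by (simp add: cocycles_def prod_zero W.fscale_zero)
  then have "Y \<bullet> C2 \<in> cocycles V W P"
    using add(2) assms(2) by (simp add: cocycles_def prod_mem)
  then show ?case
    using add assms(2) cocycles_add by (simp add: prod_add_left cocycles_L_space)
qed

lemma delta_prod_cocycle:
  assumes D: "D \<in> L_space V W" and C: "C \<in> cocycles V W P"
  shows "\<delta> D \<bullet> C \<in> cobound"
  using D
proof (induction rule: L_space_induct)
  case zero
  show ?case by (simp add: delta_zero prod_zero coboundaries_zero)
next
  case (add k c Y Z)
  note CL = cocycles_L_space[OF C] and Y = L_hom_mem_L_space[OF add(1)]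
  have "\<delta> Y \<bullet> C = \<delta> (Y \<bullet> C)"
    using delta_prod[OF add(1) CL] C by (simp add: cocycles_def prod_zero W.fscale_zero)
  then have "\<delta> Y \<bullet> C \<in> cobound"
    using prod_mem[OF Y CL] by (simp add: coboundaries_def)
  then show ?case
    using add Y CL coboundaries_add by (simp add: delta_add prod_add_left delta_mem)
qed

text \<open>For homogeneous \<open>C\<close> with sign \<open>s\<close> the derivation rule gives \<open>\<delta> (C \<bullet> D) = s (C \<bullet> \<delta> D)\<close>, and \<open>s\<^sup>2 = 1\<close>.\<close>

lemma cocycle_prod_delta:
  assumes C: "C \<in> cocycles V W P" and D: "D \<in> L_space V W"
  shows "C \<bullet> \<delta> D \<in> cobound"
  using C
proof (induction rule: cocycles_induct)
  case zero
  show ?case by (simp add: prod_zero coboundaries_zero)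
next
  case (add k c Y Z)
  note Y = L_hom_mem_L_space[OF add(1)]
  let ?s = "(-1) powi (int k - 1) :: 'k"
  have "?s * ?s = 1"
    using sign_cases[of "int k - 1", where 'k='k] by auto
  then have "Y \<bullet> \<delta> D = \<delta> (fscale W ?s (Y \<bullet> D))"
    using delta_prod[OF add(1) D] add(2) Y D
    by (simp add: cocycles_def prod_zero delta_fscale prod_mem W.fscale_fscale W.fscale_one)
  then have "Y \<bullet> \<delta> D \<in> cobound"
    using L_space_fscale[OF prod_mem[OF Y D]] by (simp add: coboundaries_def)
  then show ?case
    using add Y D coboundaries_add by (simp add: prod_add_left delta_mem cocycles_L_space)
qed

text \<open>Replace the two factors one after the other: with \<open>C\<^sub>1 = \<delta> D\<^sub>1 + C\<^sub>1'\<close> and \<open>C\<^sub>2 = \<delta> D\<^sub>2 + C\<^sub>2'\<close> the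
  products differ by \<open>\<delta> D\<^sub>1 \<bullet> C\<^sub>2 + C\<^sub>1' \<bullet> \<delta> D\<^sub>2\<close>.\<close>

lemma prod_cong_coboundaries:
  assumes C1: "C1 \<in> cocycles V W P" "C1' \<in> cocycles V W P" "cls C1 = cls C1'"
    and C2: "C2 \<in> cocycles V W P" "C2' \<in> cocycles V W P" "cls C2 = cls C2'"
  shows "cls (C1 \<bullet> C2) = cls (C1' \<bullet> C2')"
proof -
  obtain D1 where D1: "D1 \<in> L_space V W" "C1 = \<delta> D1 + C1'"
    using C1(3) by (auto simp: cls_eq_iff coboundaries_def diff_eq_eq)
  obtain D2 where D2: "D2 \<in> L_space V W" "C2 = \<delta> D2 + C2'"
    using C2(3) by (auto simp: cls_eq_iff coboundaries_def diff_eq_eq)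
  note mem = C1(1,2)[THEN cocycles_L_space] C2(1,2)[THEN cocycles_L_space] delta_mem[OF D1(1)] delta_mem[OF D2(1)]
  have "C1 \<bullet> C2 = \<delta> D1 \<bullet> C2 + C1' \<bullet> C2"
    using D1(2) prod_add_left[of "\<delta> D1" C1' C2] mem by simp
  also have "C1' \<bullet> C2 = C1' \<bullet> \<delta> D2 + C1' \<bullet> C2'"
    using D2(2) prod_add_right[of "\<delta> D2" C2' C1'] mem by simp
  finally have "C1 \<bullet> C2 - C1' \<bullet> C2' = \<delta> D1 \<bullet> C2 + C1' \<bullet> \<delta> D2"
    by simp
  then show ?thesis
    using delta_prod_cocycle[OF D1(1) C2(1)] cocycle_prod_delta[OF C1(2) D2(1)] coboundaries_add
    by (simp add: cls_eq_iff)
qed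

lemma cup_product:
  "\<exists>cup. (\<forall>C1\<in>cocycles V W P. \<forall>C2\<in>cocycles V W P. cup (cls C1) (cls C2) = cls (C1 \<bullet> C2))
     \<and> graded_product_on (coh_scale V W P) (H_space V W P) (H_hom V W P) cup"
proof -
  define rep where "rep A = (SOME C. C \<in> cocycles V W P \<and> cls C = A)" for A
  define cup where "cup A B = cls (rep A \<bullet> rep B)" for A B
  have rep: "rep (cls C) \<in> cocycles V W P \<and> cls (rep (cls C)) = cls C" if "C \<in> cocycles V W P" for C
    unfolding rep_def by (rule someI[of _ C]) (simp add: that)
  have cup: "cup (cls C1) (cls C2) = cls (C1 \<bullet> C2)"
    if "C1 \<in> cocycles V W P" "C2 \<in> cocycles V W P" for C1 C2
    unfolding cup_def using rep[OF that(1)] rep[OF that(2)] that by (intro prod_cong_coboundaries) auto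
  have "graded_product_on (coh_scale V W P) (H_space V W P) (H_hom V W P) cup"
    unfolding graded_product_on_def
  proof (intro conjI ballI allI)
    fix A B assume A: "A \<in> H_space V W P" and B: "B \<in> H_space V W P"
    obtain a where a: "a \<in> cocycles V W P" "A = cls a" using A by (rule H_space_cases)
    obtain b where b: "b \<in> cocycles V W P" "B = cls b" using B by (rule H_space_cases)
    note L = a(1)[THEN cocycles_L_space] b(1)[THEN cocycles_L_space]
    show "cup A B \<in> H_space V W P"
      using a b by (simp add: cup cls_H_space prod_cocycle)
    show "cup (coh_scale V W P r A) B = coh_scale V W P r (cup A B)"
      "cup A (coh_scale V W P r B) = coh_scale V W P r (cup A B)" for r
      using a b L by (simp_all add: cls_fscale cup cocycles_fscale prod_fscale_left prod_fscale_right)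
    fix A' assume "A' \<in> H_space V W P"
    then obtain a' where a': "a' \<in> cocycles V W P" "A' = cls a'" by (rule H_space_cases)
    note L' = a'(1)[THEN cocycles_L_space]
    show "cup (A + A') B = cup A B + cup A' B" "cup B (A + A') = cup B A + cup B A'"
      using a b a' L L' by (simp_all add: cls_add cup cocycles_add prod_add_left prod_add_right)
  next
    fix k c l d A B assume "A \<in> H_hom V W P (k, c)" "B \<in> H_hom V W P (l, d)"
    then obtain a b where "a \<in> cocycles V W P" "a \<in> L_hom V W (k, c)" "A = cls a"
      "b \<in> cocycles V W P" "b \<in> L_hom V W (l, d)" "B = cls b"
      by (auto simp: H_hom_def)
    then show "cup A B \<in> H_hom V W P (k + l, c + d)"
      by (simp add: cup H_hom_def prod_cocycle prod_hom(1))
  qed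
  then show ?thesis
    using cup by blast
qed

end

end

end

theorem theorem4p4:
  fixes V :: "('k::field_char_0, 'v::ab_group_add) gspace"
    and W :: "('k, 'w::ab_group_add) gspace"
    and n :: nat
    and P :: "('v \<times> 'w) list \<Rightarrow> 'v \<times> 'w"
    and \<nu> :: "'w list \<Rightarrow> 'w"
  assumes "graded_space n V" and "graded_space n W"
    and "P \<in> M_hom (E_space V W) (1, 0)"
    and "bracket (E_space V W) P P = 0"
    and "\<nu> \<in> mlin W W 2 0"
  shows
    \<comment> \<open>(1): \<open>[P, \<cdot>]\<^sup>\<Delta>\<close> is a differential on \<open>M(E)\<close>; it restricts to \<open>\<delta>\<^sub>P\<close> on \<open>L(V, W)\<close>, given by the
       multigraded Hochschild formula (with the overall minus sign and the sign of the first term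
       that the definition of the bracket forces)\<close>
    "differential_on (fscale (E_space V W)) (M_space (E_space V W)) (bracket (E_space V W) P)
     \<and> (\<forall>C\<in>L_space V W. delta V W P C \<in> L_space V W \<and>
          extV (delta V W P C) = bracket (E_space V W) P (extV C))
     \<and> (\<forall>k c C xs Xs. C \<in> L_hom V W (k, c) \<longrightarrow> length xs = Suc k \<longrightarrow> homogeneous_list V xs Xs \<longrightarrow>
          delta V W P C Xs =
          - (gscale W ((-1) powi deg_inner n (xs ! 0) c) (lam P (Xs ! 0) (C (tl Xs)))
             - (\<Sum>i<k. gscale W ((-1) ^ i)
                  (C (take i Xs @ [mu P (Xs ! i) (Xs ! Suc i)] @ drop (i + 2) Xs)))
             + gscale W ((-1) powi (int k + 1 + deg_inner n (sum_list (take k xs) + c) (xs ! k)))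
                 (rho V W P (Xs ! k) (C (take k Xs)))))
     \<and> extW \<nu> \<in> M_hom (E_space V W) (1, case_nat (-1) 0)
     \<and> (\<forall>C1\<in>L_space V W. \<forall>C2\<in>L_space V W.
          extV (bullet V W \<nu> C1 C2) =
          bracket (E_space V W) (extV C1) (bracket (E_space V W) (extV C2) (extW \<nu>)))
     \<and> graded_product_on (fscale W) (L_space V W) (L_hom V W) (bullet V W \<nu>)
     \<comment> \<open>(2)\<close>
     \<and> (bracket (E_space V W) P (extW \<nu>) = 0 \<longrightarrow>
          (\<forall>k c. \<forall>C\<in>L_hom V W (k, c). delta V W P C \<in> L_hom V W (Suc k, c))
          \<and> (\<forall>k1 c1. \<forall>C1\<in>L_hom V W (k1, c1). \<forall>C2\<in>L_space V W.
               delta V W P (bullet V W \<nu> C1 C2) =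
               bullet V W \<nu> (delta V W P C1) C2
               + fscale W ((-1) powi (int k1 - 1)) (bullet V W \<nu> C1 (delta V W P C2)))
          \<and> H_graded V W P
          \<and> (\<exists>cup. (\<forall>C1\<in>cocycles V W P. \<forall>C2\<in>cocycles V W P.
                      cup (coh_class V W P C1) (coh_class V W P C2) =
                      coh_class V W P (bullet V W \<nu> C1 C2))
                 \<and> graded_product_on (coh_scale V W P) (H_space V W P) (H_hom V W P) cup))"
proof -
  have n: "grank V = n" "grank W = n"
    using assms(1,2) by (simp_all add: graded_space_def)
  interpret multigraded_bimodule_product V W P \<nu>
    by unfold_locales (use assms n in simp_all)
  show ?thesis
    using differential delta_mem extV_delta delta_formula[unfolded n] extW_hom extV_prod graded_product
      delta_hom(1) delta_prod H_graded cup_product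
    by (intro conjI impI ballI allI) blast+
qed

end
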